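(* Let $(W,S)$ be a Coxeter system with $S$ finite and $L$ a positive weight function on $W$, with Hecke algebra $\mathcal H$. Suppose that $(\pi_\Gamma,\mathcal M_\Gamma,\mathsf B_\Gamma)_{\Gamma\in\Lambda}$ is a family of matrix representations of $\mathcal H$, indexed by the two-sided cells, satisfying B1--B5 and B4$'$. Then for each $\Gamma\in\Lambda$ the ring $\mathcal J_\Gamma$ spanned over $\mathbb Z$ by the leading matrices $\{\mathfrak c_{\pi_\Gamma,w}\mid w\in\Gamma\}$ is isomorphic to Lusztig's asymptotic algebra associated to $\Gamma$.
   Context: A positive weight function is $L:W\to\mathbb N$ with $L(w)>0$ for $w\ne e$ and $L(ww')=L(w)+L(w')$ whenever $\ell(ww')=\ell(w)+\ell(w')$. $R=\mathbb Z[q,q^{-1}]$; $\mathcal H$ is the $R$-algebra with basis $\{T_w\}$ and $T_wT_s=T_{ws}$ if $\ell(ws)>\ell(w)$, $T_wT_s=T_{ws}+(q^{L(s)}-q^{-L(s)})T_w$ otherwise. The Kazhdan--Lusztig basis $\{C_w\}$ is the unique basis with $\overline{C_w}=C_w$ (bar involution: $\overline q=q^{-1}$, $\overline{T_w}=T_{w^{-1}}^{-1}$) and $C_w\in T_w+\sum_{y<w}q^{-1}\mathbb Z[q^{-1}]T_y$. $C_xC_y=\sum_zh_{x,y,z}C_z$. Lusztig's $\mathbf a$-function: $\mathbf a(z)=\min\{n\in\mathbb N\mid q^{-n}h_{x,y,z}\in\mathbb Z[q^{-1}]\ \forall x,y\in W\}$, and $\gamma_{x,y,z^{-1}}$ is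 the constant term of $q^{-\mathbf a(z)}h_{x,y,z}$. Lusztig's asymptotic algebra associated to a two-sided cell $\Gamma$ is the $\mathbb Z$-algebra with $\mathbb Z$-basis $\{J_w\mid w\in\Gamma\}$ and multiplication $J_xJ_y=\sum_{z\in\Gamma}\gamma_{x,y,z^{-1}}J_z$. The preorder $\le_{\mathcal{LR}}$ is the transitive closure of: $x\le y$ if $C_x$ appears in the Kazhdan--Lusztig expansion of $hC_yh'$ for some $h,h'\in\mathcal H$; $\Lambda$ is the set of its equivalence classes (two-sided cells), partially ordered by $\le_{\mathcal{LR}}$; $\Gamma_{\ge_{\mathcal{LR}}}=\{w\in W\mid\exists x\in\Gamma,\ w\ge_{\mathcal{LR}}x\}$. An $R$-polynomial ring is a (Laurent) polynomial ring $\mathsf S$ over $R$ in finitely many (possibly zero) commuting indeterminates; $\mathsf S^{\le0}$ and $\mathsf S^0$ are the corresponding subrings with coefficients in $\mathbb Z[q^{-1}]$ and $\mathbb Z$, and $\mathrm{sp}:\mathsf S^{\le0}\to\mathsf S^0$ is specialisation at $q^{-1}=0$. A matrix representation is a triple $(\pi,\mathcal M,\mathsf B)$ with $\mathcal M$ a right $\mathcal H$-module over an $R$-polynomial ring $\mathsf S$, and $\mathsf B$ an $\mathsf S$-basis of $\mathcal M$; matrices are defined by $u\cdot h=\sum_{v\in\mathsf B}[\pi(h)]_{u,v}v$. It is bounded if there is $n\ge0$ with $q^{-n}[\pi(C_w)]_{u,v}\in\mathsf S^{\le0}$ for all $u,v\in\mathsf B$, $w\in W$; the least such $n\in\mathbb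 N$ is the bound $\mathbf a_\pi$, and the leading matrices are $\mathfrak c_{\pi,w}=\mathrm{sp}(q^{-\mathbf a_\pi}\pi(C_w))$. Axioms for $(\pi_\Gamma,\mathcal M_\Gamma,\mathsf B_\Gamma)_{\Gamma\in\Lambda}$ (each over an $R$-polynomial ring $R_\Gamma$), for all $\Gamma$: B1. If $w\notin\Gamma_{\ge_{\mathcal{LR}}}$ then $\pi_\Gamma(C_w)=0$. B2. The matrix representation is bounded, with bound $\mathbf a_{\pi_\Gamma}$. B3. $\mathfrak c_{\pi_\Gamma,w}\ne0$ if and only if $w\in\Gamma$. B4. The leading matrices $\mathfrak c_{\pi_\Gamma,w}$, $w\in\Gamma$, are free over $\mathbb Z$. B5. If $\Gamma'\le_{\mathcal{LR}}\Gamma$ then $\mathbf a_{\pi_{\Gamma'}}\ge\mathbf a_{\pi_\Gamma}$. B4$'$. For each $z\in\Gamma$ there exists $(x,y)\in\Gamma^2$ with $\tilde\gamma_{x,y,z^{-1}}\neq0$, where $\tilde\gamma_{x,y,z^{-1}}$ is the coefficient of $q^{\mathbf a_{\pi_\Gamma}}$ in $h_{x,y,z}$. *)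

theory Defs
  imports "HOL-Algebra.Module" "HOL-Library.Poly_Mapping"
begin

section \<open>Coxeter systems, length, Bruhat order, weight functions\<close>

definition word_prod :: "('w, 'b) monoid_scheme \<Rightarrow> 'w list \<Rightarrow> 'w" where
  "word_prod G ws = foldr (\<lambda>x y. x \<otimes>\<^bsub>G\<^esub> y) ws \<one>\<^bsub>G\<^esub>"

text \<open>Group words: the letter \<open>(s, True)\<close> stands for \<open>s\<close> and \<open>(s, False)\<close> for its inverse.\<close>

definition eval_word :: "('w, 'b) monoid_scheme \<Rightarrow> ('w \<times> bool) list \<Rightarrow> 'w" where
  "eval_word G ws = word_prod G (map (\<lambda>(s, b). if b then s else inv\<^bsub>G\<^esub> s) ws)"

inductive presentation_step ::
  "'w set \<Rightarrow> ('w \<times> bool) list set \<Rightarrow> ('w \<times> bool) list \<Rightarrow> ('w \<times> bool) list \<Rightarrow> bool"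
  for S Rel where
  cancel: "s \<in> S \<Longrightarrow> presentation_step S Rel (u @ [(s, b), (s, \<not> b)] @ v) (u @ v)"
| relator: "r \<in> Rel \<Longrightarrow> presentation_step S Rel (u @ r @ v) (u @ v)"

text \<open>\<open>G\<close> is the group presented by the generators \<open>S\<close> and the relators \<open>Rel\<close>: every element is
  represented by a word, and two words represent the same element iff they agree in the quotient of
  the free group on \<open>S\<close> by the normal closure of \<open>Rel\<close>.\<close>

definition group_presented_by ::
  "('w, 'b) monoid_scheme \<Rightarrow> 'w set \<Rightarrow> ('w \<times> bool) list set \<Rightarrow> bool" where
  "group_presented_by G S Rel \<longleftrightarrow>
     group G \<and> S \<subseteq> carrier G \<and>
     eval_word G ` lists (S \<times> UNIV) = carrier G \<and>
     (\<forall>u\<in>lists (S \<times> UNIV). \<forall>v\<in>lists (S \<times> UNIV).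
        eval_word G u = eval_word G v \<longleftrightarrow> equivclp (presentation_step S Rel) u v)"

text \<open>In a Coxeter matrix, the entry \<open>0\<close> encodes \<open>m(s,t) = \<infinity>\<close>, i.e. no relation.\<close>

definition coxeter_matrix :: "'w set \<Rightarrow> ('w \<Rightarrow> 'w \<Rightarrow> nat) \<Rightarrow> bool" where
  "coxeter_matrix S m \<longleftrightarrow>
     (\<forall>s\<in>S. m s s = 1) \<and> (\<forall>s\<in>S. \<forall>t\<in>S. s \<noteq> t \<longrightarrow> m s t = m t s \<and> m s t \<noteq> 1)"

definition coxeter_relators :: "'w set \<Rightarrow> ('w \<Rightarrow> 'w \<Rightarrow> nat) \<Rightarrow> ('w \<times> bool) list set" where
  "coxeter_relators S m =
     {concat (replicate (m s t) [(s, True), (t, True)]) | s t. s \<in> S \<and> t \<in> S \<and> m s t \<noteq> 0}"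

definition coxeter_system :: "('w, 'b) monoid_scheme \<Rightarrow> 'w set \<Rightarrow> bool" where
  "coxeter_system G S \<longleftrightarrow>
     (\<exists>m. coxeter_matrix S m \<and> group_presented_by G S (coxeter_relators S m))"

definition cox_length :: "('w, 'b) monoid_scheme \<Rightarrow> 'w set \<Rightarrow> 'w \<Rightarrow> nat" where
  "cox_length G S w = (LEAST n. \<exists>ws\<in>lists S. length ws = n \<and> word_prod G ws = w)"

definition reflections :: "('w, 'b) monoid_scheme \<Rightarrow> 'w set \<Rightarrow> 'w set" where
  "reflections G S = {g \<otimes>\<^bsub>G\<^esub> s \<otimes>\<^bsub>G\<^esub> inv\<^bsub>G\<^esub> g | g s. g \<in> carrier G \<and> s \<in> S}"

text \<open>The strict Bruhat order.\<close>

definition bruhat_less :: "('w, 'b) monoid_scheme \<Rightarrow> 'w set \<Rightarrow> 'w \<Rightarrow> 'w \<Rightarrow> bool" where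
  "bruhat_less G S =
     (\<lambda>y w. y \<in> carrier G \<and> w \<in> carrier G \<and> cox_length G S y < cox_length G S w \<and>
            (\<exists>t\<in>reflections G S. w = y \<otimes>\<^bsub>G\<^esub> t))\<^sup>+\<^sup>+"

definition positive_weight_function ::
  "('w, 'b) monoid_scheme \<Rightarrow> 'w set \<Rightarrow> ('w \<Rightarrow> nat) \<Rightarrow> bool" where
  "positive_weight_function G S L \<longleftrightarrow>
     (\<forall>w\<in>carrier G. w \<noteq> \<one>\<^bsub>G\<^esub> \<longrightarrow> L w > 0) \<and>
     (\<forall>w\<in>carrier G. \<forall>w'\<in>carrier G.
        cox_length G S (w \<otimes>\<^bsub>G\<^esub> w') = cox_length G S w + cox_length G S w' \<longrightarrow>
        L (w \<otimes>\<^bsub>G\<^esub> w') = L w + L w')"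

section \<open>Coefficient rings\<close>

text \<open>A Laurent polynomial in \<open>q\<close> over the integers is a finitely supported function from
  exponents to coefficients; the multiplication of \<open>\<Rightarrow>\<^sub>0\<close> is convolution.\<close>

type_synonym laurent = "int \<Rightarrow>\<^sub>0 int"

definition qpow :: "int \<Rightarrow> laurent" where
  "qpow n = Poly_Mapping.single n 1"

definition laurent_bar :: "laurent \<Rightarrow> laurent" where
  "laurent_bar r = Poly_Mapping.map_key uminus r"

text \<open>The subring of polynomials in the inverse of \<open>q\<close>, and its ideal generated by that inverse.\<close>

definition nonpos_laurent :: "laurent set" where
  "nonpos_laurent = {r. \<forall>n>0. Poly_Mapping.lookup r n = 0}"

definition neg_laurent :: "laurent set" where
  "neg_laurent = {r. \<forall>n\<ge>0. Poly_Mapping.lookup r n = 0}"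

definition ring_on :: "'a::comm_ring_1 set \<Rightarrow> 'a ring" where
  "ring_on A = \<lparr>carrier = A, monoid.mult = (*), one = 1, ring.zero = 0, ring.add = (+)\<rparr>"

definition laurent_ring :: "laurent ring" where
  "laurent_ring = ring_on UNIV"

text \<open>Laurent polynomials over \<open>laurent\<close> in indeterminates numbered by natural numbers; a monomial
  is given by its finitely supported exponent vector.\<close>

type_synonym mlaurent = "(nat \<Rightarrow>\<^sub>0 int) \<Rightarrow>\<^sub>0 laurent"

text \<open>The ring in the indeterminates \<open>X\<close>, where those in \<open>X \<inter> Y\<close> are invertible: a polynomial
  ring for \<open>Y = {}\<close>, a Laurent polynomial ring for \<open>Y = X\<close>.\<close>

definition rpoly_ring :: "nat set \<Rightarrow> nat set \<Rightarrow> mlaurent ring" where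
  "rpoly_ring X Y = ring_on {f. \<forall>e\<in>Poly_Mapping.keys f. Poly_Mapping.keys e \<subseteq> X \<and>
                                  (\<forall>i. Poly_Mapping.lookup e i < 0 \<longrightarrow> i \<in> Y)}"

definition is_rpoly_ring :: "mlaurent ring \<Rightarrow> bool" where
  "is_rpoly_ring A \<longleftrightarrow> (\<exists>X Y. finite X \<and> A = rpoly_ring X Y)"

definition of_laurent :: "laurent \<Rightarrow> mlaurent" where
  "of_laurent r = Poly_Mapping.single 0 r"

definition nonpos_part :: "mlaurent ring \<Rightarrow> mlaurent set" where
  "nonpos_part A = {f\<in>carrier A. \<forall>e. Poly_Mapping.lookup f e \<in> nonpos_laurent}"

text \<open>Specialisation at \<open>1/q = 0\<close>: keep the constant term of each coefficient. Only meaningful on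
  \<open>nonpos_part\<close>; the values have integer coefficients, viewed in the same ring.\<close>

definition sp :: "mlaurent \<Rightarrow> mlaurent" where
  "sp f = Poly_Mapping.map (\<lambda>r. Poly_Mapping.single 0 (Poly_Mapping.lookup r 0)) f"

section \<open>Bases and coordinates\<close>

definition fin_coeffs :: "('a, 'r) ring_scheme \<Rightarrow> 'i set \<Rightarrow> ('i \<Rightarrow> 'a) set" where
  "fin_coeffs R I = {c. (\<forall>i. c i \<in> carrier R) \<and> finite {i. c i \<noteq> \<zero>\<^bsub>R\<^esub>} \<and> {i. c i \<noteq> \<zero>\<^bsub>R\<^esub>} \<subseteq> I}"

definition lin_comb ::
  "('a, 'r) ring_scheme \<Rightarrow> ('a, 'm, 'k) module_scheme \<Rightarrow> ('i \<Rightarrow> 'm) \<Rightarrow> ('i \<Rightarrow> 'a) \<Rightarrow> 'm" where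
  "lin_comb R M b c = finsum M (\<lambda>i. c i \<odot>\<^bsub>M\<^esub> b i) {i. c i \<noteq> \<zero>\<^bsub>R\<^esub>}"

definition is_basis ::
  "('a, 'r) ring_scheme \<Rightarrow> ('a, 'm, 'k) module_scheme \<Rightarrow> 'i set \<Rightarrow> ('i \<Rightarrow> 'm) \<Rightarrow> bool" where
  "is_basis R M I b \<longleftrightarrow>
     b \<in> I \<rightarrow> carrier M \<and> (\<forall>x\<in>carrier M. \<exists>!c. c \<in> fin_coeffs R I \<and> x = lin_comb R M b c)"

definition coords ::
  "('a, 'r) ring_scheme \<Rightarrow> ('a, 'm, 'k) module_scheme \<Rightarrow> 'i set \<Rightarrow> ('i \<Rightarrow> 'm) \<Rightarrow> 'm \<Rightarrow> 'i \<Rightarrow> 'a" where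
  "coords R M I b x = (THE c. c \<in> fin_coeffs R I \<and> x = lin_comb R M b c)"

section \<open>Hecke algebra and Kazhdan--Lusztig basis\<close>

text \<open>Since the locale \<open>algebra\<close> of HOL-Algebra is restricted to commutative algebras, the algebra
  axioms are spelled out.\<close>

definition hecke_algebra ::
  "('w, 'b) monoid_scheme \<Rightarrow> 'w set \<Rightarrow> ('w \<Rightarrow> nat) \<Rightarrow> (laurent, 'h) module \<Rightarrow> ('w \<Rightarrow> 'h) \<Rightarrow> bool" where
  "hecke_algebra G S L H T \<longleftrightarrow>
     ring H \<and> Module.module laurent_ring H \<and>
     (\<forall>r. \<forall>h\<in>carrier H. \<forall>h'\<in>carrier H.
        (r \<odot>\<^bsub>H\<^esub> h) \<otimes>\<^bsub>H\<^esub> h' = r \<odot>\<^bsub>H\<^esub> (h \<otimes>\<^bsub>H\<^esub> h') \<and>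
        h \<otimes>\<^bsub>H\<^esub> (r \<odot>\<^bsub>H\<^esub> h') = r \<odot>\<^bsub>H\<^esub> (h \<otimes>\<^bsub>H\<^esub> h')) \<and>
     is_basis laurent_ring H (carrier G) T \<and>
     (\<forall>w\<in>carrier G. \<forall>s\<in>S.
        T w \<otimes>\<^bsub>H\<^esub> T s =
          (if cox_length G S (w \<otimes>\<^bsub>G\<^esub> s) > cox_length G S w then T (w \<otimes>\<^bsub>G\<^esub> s)
           else T (w \<otimes>\<^bsub>G\<^esub> s) \<oplus>\<^bsub>H\<^esub> (qpow (int (L s)) - qpow (- int (L s))) \<odot>\<^bsub>H\<^esub> T w))"

text \<open>The bar involution, written out on coordinates: it is semilinear for \<open>laurent_bar\<close> and maps
  \<open>T w\<close> to the inverse of \<open>T (inv w)\<close>.\<close>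

definition hecke_bar ::
  "('w, 'b) monoid_scheme \<Rightarrow> (laurent, 'h) module \<Rightarrow> ('w \<Rightarrow> 'h) \<Rightarrow> 'h \<Rightarrow> 'h" where
  "hecke_bar G H T h =
     lin_comb laurent_ring H (\<lambda>w. inv\<^bsub>H\<^esub> (T (inv\<^bsub>G\<^esub> w)))
       (\<lambda>w. laurent_bar (coords laurent_ring H (carrier G) T h w))"

definition kazhdan_lusztig_basis ::
  "('w, 'b) monoid_scheme \<Rightarrow> 'w set \<Rightarrow> (laurent, 'h) module \<Rightarrow> ('w \<Rightarrow> 'h) \<Rightarrow> ('w \<Rightarrow> 'h) \<Rightarrow> bool" where
  "kazhdan_lusztig_basis G S H T C \<longleftrightarrow>
     is_basis laurent_ring H (carrier G) C \<and>
     (\<forall>w\<in>carrier G.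
        hecke_bar G H T (C w) = C w \<and>
        (\<exists>p \<in> fin_coeffs laurent_ring {y. bruhat_less G S y w}.
           (\<forall>y. p y \<in> neg_laurent) \<and> C w = T w \<oplus>\<^bsub>H\<^esub> lin_comb laurent_ring H T p))"

text \<open>The structure constants \<open>h(x,y,z)\<close>.\<close>

definition kl_struct ::
  "('w, 'b) monoid_scheme \<Rightarrow> (laurent, 'h) module \<Rightarrow> ('w \<Rightarrow> 'h) \<Rightarrow> 'w \<Rightarrow> 'w \<Rightarrow> 'w \<Rightarrow> laurent" where
  "kl_struct G H C x y z = coords laurent_ring H (carrier G) C (C x \<otimes>\<^bsub>H\<^esub> C y) z"

section \<open>Two-sided cells\<close>

definition le_LR ::
  "('w, 'b) monoid_scheme \<Rightarrow> (laurent, 'h) module \<Rightarrow> ('w \<Rightarrow> 'h) \<Rightarrow> 'w \<Rightarrow> 'w \<Rightarrow> bool" where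
  "le_LR G H C =
     (\<lambda>x y. x \<in> carrier G \<and> y \<in> carrier G \<and>
            (\<exists>h\<in>carrier H. \<exists>h'\<in>carrier H.
               coords laurent_ring H (carrier G) C (h \<otimes>\<^bsub>H\<^esub> C y \<otimes>\<^bsub>H\<^esub> h') x \<noteq> 0))\<^sup>+\<^sup>+"

definition two_sided_cells ::
  "('w, 'b) monoid_scheme \<Rightarrow> (laurent, 'h) module \<Rightarrow> ('w \<Rightarrow> 'h) \<Rightarrow> 'w set set" where
  "two_sided_cells G H C = carrier G // {(x, y). le_LR G H C x y \<and> le_LR G H C y x}"

definition cell_le ::
  "('w, 'b) monoid_scheme \<Rightarrow> (laurent, 'h) module \<Rightarrow> ('w \<Rightarrow> 'h) \<Rightarrow> 'w set \<Rightarrow> 'w set \<Rightarrow> bool" where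
  "cell_le G H C \<Gamma>' \<Gamma> \<longleftrightarrow> (\<exists>x\<in>\<Gamma>'. \<exists>y\<in>\<Gamma>. le_LR G H C x y)"

definition cell_upper ::
  "('w, 'b) monoid_scheme \<Rightarrow> (laurent, 'h) module \<Rightarrow> ('w \<Rightarrow> 'h) \<Rightarrow> 'w set \<Rightarrow> 'w set" where
  "cell_upper G H C \<Gamma> = {w\<in>carrier G. \<exists>x\<in>\<Gamma>. le_LR G H C x w}"

section \<open>Rings without unit\<close>

text \<open>For an infinite cell the asymptotic algebra need not have a unit, whereas the records and
  locales for rings in HOL-Algebra require one.\<close>

record 'a rng = "'a partial_object" +
  rng_zero :: 'a
  rng_add :: "'a \<Rightarrow> 'a \<Rightarrow> 'a"
  rng_mult :: "'a \<Rightarrow> 'a \<Rightarrow> 'a"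

definition is_rng :: "'a rng \<Rightarrow> bool" where
  "is_rng A \<longleftrightarrow>
     comm_group \<lparr>carrier = carrier A, monoid.mult = rng_add A, one = rng_zero A\<rparr> \<and>
     (\<forall>x\<in>carrier A. \<forall>y\<in>carrier A. rng_mult A x y \<in> carrier A) \<and>
     (\<forall>x\<in>carrier A. \<forall>y\<in>carrier A. \<forall>z\<in>carrier A.
        rng_mult A (rng_mult A x y) z = rng_mult A x (rng_mult A y z) \<and>
        rng_mult A (rng_add A x y) z = rng_add A (rng_mult A x z) (rng_mult A y z) \<and>
        rng_mult A x (rng_add A y z) = rng_add A (rng_mult A x y) (rng_mult A x z))"

definition rng_isomorphic :: "'a rng \<Rightarrow> 'c rng \<Rightarrow> bool" where
  "rng_isomorphic A B \<longleftrightarrow>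
     is_rng A \<and> is_rng B \<and>
     (\<exists>\<phi>. bij_betw \<phi> (carrier A) (carrier B) \<and>
        (\<forall>x\<in>carrier A. \<forall>y\<in>carrier A.
           \<phi> (rng_add A x y) = rng_add B (\<phi> x) (\<phi> y) \<and>
           \<phi> (rng_mult A x y) = rng_mult B (\<phi> x) (\<phi> y)))"

section \<open>Lusztig's a-function and asymptotic algebra\<close>

definition a_admissible ::
  "('w, 'b) monoid_scheme \<Rightarrow> (laurent, 'h) module \<Rightarrow> ('w \<Rightarrow> 'h) \<Rightarrow> 'w \<Rightarrow> nat \<Rightarrow> bool" where
  "a_admissible G H C z n \<longleftrightarrow>
     (\<forall>x\<in>carrier G. \<forall>y\<in>carrier G. qpow (- int n) * kl_struct G H C x y z \<in> nonpos_laurent)"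

text \<open>Meaningful only if some \<open>n\<close> is admissible.\<close>

definition lusztig_a ::
  "('w, 'b) monoid_scheme \<Rightarrow> (laurent, 'h) module \<Rightarrow> ('w \<Rightarrow> 'h) \<Rightarrow> 'w \<Rightarrow> nat" where
  "lusztig_a G H C z = (LEAST n. a_admissible G H C z n)"

text \<open>The third argument is the inverse of the index of the structure constant.\<close>

definition lusztig_gamma ::
  "('w, 'b) monoid_scheme \<Rightarrow> (laurent, 'h) module \<Rightarrow> ('w \<Rightarrow> 'h) \<Rightarrow> 'w \<Rightarrow> 'w \<Rightarrow> 'w \<Rightarrow> int" where
  "lusztig_gamma G H C x y z' =
     (let z = inv\<^bsub>G\<^esub> z' in
      Poly_Mapping.lookup (qpow (- int (lusztig_a G H C z)) * kl_struct G H C x y z) 0)"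

definition int_combs :: "'w set \<Rightarrow> ('w \<Rightarrow> int) set" where
  "int_combs \<Gamma> = {f. finite {w. f w \<noteq> 0} \<and> {w. f w \<noteq> 0} \<subseteq> \<Gamma>}"

text \<open>The function \<open>f\<close> in \<open>int_combs \<Gamma>\<close> represents the sum of all \<open>f w\<close> times the basis
  element indexed by \<open>w\<close>; the product is the bilinear extension of the product of basis elements.\<close>

definition asymptotic_algebra ::
  "('w, 'b) monoid_scheme \<Rightarrow> (laurent, 'h) module \<Rightarrow> ('w \<Rightarrow> 'h) \<Rightarrow> 'w set \<Rightarrow> ('w \<Rightarrow> int) rng" where
  "asymptotic_algebra G H C \<Gamma> =
     \<lparr>carrier = int_combs \<Gamma>,
      rng_zero = (\<lambda>w. 0),
      rng_add = (\<lambda>f g w. f w + g w),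
      rng_mult = (\<lambda>f g z.
         if z \<in> \<Gamma> then \<Sum>x | f x \<noteq> 0. \<Sum>y | g y \<noteq> 0.
           f x * g y * lusztig_gamma G H C x y (inv\<^bsub>G\<^esub> z)
         else 0)\<rparr>"

section \<open>Matrix representations\<close>

record ('h, 'm) matrix_rep =
  rep_ring :: "mlaurent ring"
  rep_module :: "(mlaurent, 'm) module"
  rep_act :: "'m \<Rightarrow> 'h \<Rightarrow> 'm"
  rep_basis :: "'m set"

text \<open>The underlying object is a module over \<open>rep_ring\<close> (whose own multiplication, part of the
  record type, is irrelevant) with a compatible right action of \<open>H\<close>.\<close>

definition matrix_representation :: "(laurent, 'h) module \<Rightarrow> ('h, 'm) matrix_rep \<Rightarrow> bool" where
  "matrix_representation H \<rho> \<longleftrightarrow>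
     (let A = rep_ring \<rho>; M = rep_module \<rho>; act = rep_act \<rho> in
      is_rpoly_ring A \<and> Module.module A M \<and>
      is_basis A M (rep_basis \<rho>) (\<lambda>v. v) \<and>
      (\<forall>u\<in>carrier M. \<forall>h\<in>carrier H. act u h \<in> carrier M) \<and>
      (\<forall>u\<in>carrier M. \<forall>v\<in>carrier M. \<forall>h\<in>carrier H.
         act (u \<oplus>\<^bsub>M\<^esub> v) h = act u h \<oplus>\<^bsub>M\<^esub> act v h) \<and>
      (\<forall>u\<in>carrier M. \<forall>h\<in>carrier H. \<forall>a\<in>carrier A.
         act (a \<odot>\<^bsub>M\<^esub> u) h = a \<odot>\<^bsub>M\<^esub> act u h) \<and>
      (\<forall>u\<in>carrier M. \<forall>h\<in>carrier H. \<forall>h'\<in>carrier H.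
         act u (h \<oplus>\<^bsub>H\<^esub> h') = act u h \<oplus>\<^bsub>M\<^esub> act u h' \<and>
         act u (h \<otimes>\<^bsub>H\<^esub> h') = act (act u h) h') \<and>
      (\<forall>u\<in>carrier M. \<forall>h\<in>carrier H. \<forall>r.
         act u (r \<odot>\<^bsub>H\<^esub> h) = of_laurent r \<odot>\<^bsub>M\<^esub> act u h) \<and>
      (\<forall>u\<in>carrier M. act u \<one>\<^bsub>H\<^esub> = u))"

text \<open>Matrices are indexed by \<open>rep_basis \<times> rep_basis\<close> and zero elsewhere. Each row has finite
  support, also when the basis is infinite.\<close>

definition rep_matrix :: "('h, 'm) matrix_rep \<Rightarrow> 'h \<Rightarrow> 'm \<Rightarrow> 'm \<Rightarrow> mlaurent" where
  "rep_matrix \<rho> h u v =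
     (if u \<in> rep_basis \<rho>
      then coords (rep_ring \<rho>) (rep_module \<rho>) (rep_basis \<rho>) (\<lambda>v. v) (rep_act \<rho> u h) v
      else 0)"

definition bounded_by ::
  "('w, 'b) monoid_scheme \<Rightarrow> ('w \<Rightarrow> 'h) \<Rightarrow> ('h, 'm) matrix_rep \<Rightarrow> nat \<Rightarrow> bool" where
  "bounded_by G C \<rho> n \<longleftrightarrow>
     (\<forall>u\<in>rep_basis \<rho>. \<forall>v\<in>rep_basis \<rho>. \<forall>w\<in>carrier G.
        of_laurent (qpow (- int n)) * rep_matrix \<rho> (C w) u v \<in> nonpos_part (rep_ring \<rho>))"

definition bounded_rep ::
  "('w, 'b) monoid_scheme \<Rightarrow> ('w \<Rightarrow> 'h) \<Rightarrow> ('h, 'm) matrix_rep \<Rightarrow> bool" where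
  "bounded_rep G C \<rho> \<longleftrightarrow> (\<exists>n. bounded_by G C \<rho> n)"

definition rep_bound ::
  "('w, 'b) monoid_scheme \<Rightarrow> ('w \<Rightarrow> 'h) \<Rightarrow> ('h, 'm) matrix_rep \<Rightarrow> nat" where
  "rep_bound G C \<rho> = (LEAST n. bounded_by G C \<rho> n)"

definition leading_matrix ::
  "('w, 'b) monoid_scheme \<Rightarrow> ('w \<Rightarrow> 'h) \<Rightarrow> ('h, 'm) matrix_rep \<Rightarrow> 'w \<Rightarrow> 'm \<Rightarrow> 'm \<Rightarrow> mlaurent" where
  "leading_matrix G C \<rho> w u v =
     sp (of_laurent (qpow (- int (rep_bound G C \<rho>))) * rep_matrix \<rho> (C w) u v)"

definition int_lin_comb ::
  "('w \<Rightarrow> 'm \<Rightarrow> 'm \<Rightarrow> mlaurent) \<Rightarrow> ('w \<Rightarrow> int) \<Rightarrow> 'm \<Rightarrow> 'm \<Rightarrow> mlaurent" where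
  "int_lin_comb X f u v = (\<Sum>w | f w \<noteq> 0. of_int (f w) * X w u v)"

text \<open>The sum in the matrix product is finite for matrices with finitely supported rows.\<close>

definition leading_ring ::
  "('w, 'b) monoid_scheme \<Rightarrow> ('w \<Rightarrow> 'h) \<Rightarrow> ('h, 'm) matrix_rep \<Rightarrow> 'w set \<Rightarrow> ('m \<Rightarrow> 'm \<Rightarrow> mlaurent) rng" where
  "leading_ring G C \<rho> \<Gamma> =
     \<lparr>carrier = int_lin_comb (leading_matrix G C \<rho>) ` int_combs \<Gamma>,
      rng_zero = (\<lambda>u v. 0),
      rng_add = (\<lambda>A B u v. A u v + B u v),
      rng_mult = (\<lambda>A B u v. \<Sum>t | A u t \<noteq> 0. A u t * B t v)\<rparr>"

section \<open>The axioms for a family of matrix representations indexed by the cells\<close>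

context
  fixes G :: "('w, 'b) monoid_scheme" and H :: "(laurent, 'h) module" and C :: "'w \<Rightarrow> 'h"
    and \<rho> :: "'w set \<Rightarrow> ('h, 'm) matrix_rep"
begin

definition axiom_B1 :: "'w set \<Rightarrow> bool" where
  "axiom_B1 \<Gamma> \<longleftrightarrow> (\<forall>w\<in>carrier G. w \<notin> cell_upper G H C \<Gamma> \<longrightarrow> rep_matrix (\<rho> \<Gamma>) (C w) = (\<lambda>u v. 0))"

definition axiom_B2 :: "'w set \<Rightarrow> bool" where
  "axiom_B2 \<Gamma> \<longleftrightarrow> bounded_rep G C (\<rho> \<Gamma>)"

definition axiom_B3 :: "'w set \<Rightarrow> bool" where
  "axiom_B3 \<Gamma> \<longleftrightarrow> (\<forall>w\<in>carrier G. leading_matrix G C (\<rho> \<Gamma>) w \<noteq> (\<lambda>u v. 0) \<longleftrightarrow> w \<in> \<Gamma>)"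

definition axiom_B4 :: "'w set \<Rightarrow> bool" where
  "axiom_B4 \<Gamma> \<longleftrightarrow>
     (\<forall>f\<in>int_combs \<Gamma>. int_lin_comb (leading_matrix G C (\<rho> \<Gamma>)) f = (\<lambda>u v. 0) \<longrightarrow> f = (\<lambda>w. 0))"

definition axiom_B5 :: "'w set \<Rightarrow> bool" where
  "axiom_B5 \<Gamma> \<longleftrightarrow>
     (\<forall>\<Gamma>'\<in>two_sided_cells G H C. cell_le G H C \<Gamma>' \<Gamma> \<longrightarrow>
        rep_bound G C (\<rho> \<Gamma>') \<ge> rep_bound G C (\<rho> \<Gamma>))"

definition axiom_B4' :: "'w set \<Rightarrow> bool" where
  "axiom_B4' \<Gamma> \<longleftrightarrow>
     (\<forall>z\<in>\<Gamma>. \<exists>x\<in>\<Gamma>. \<exists>y\<in>\<Gamma>.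
        Poly_Mapping.lookup (kl_struct G H C x y z) (int (rep_bound G C (\<rho> \<Gamma>))) \<noteq> 0)"

end

end

theory Submission
  imports Defs
begin

text \<open>Specialising \<open>\<pi>(C\<^sub>x) \<pi>(C\<^sub>y) = \<Sum>\<^sub>w h(x,y,w) \<pi>(C\<^sub>w)\<close>, rescaled by a power of \<open>q\<close>, at
  \<open>1/q = 0\<close> turns it into a relation between the leading matrices of a cell. Taking a structure
  constant of too large degree, with this degree maximal, gives a linear dependence contradicting B4.
  Hence \<open>h(x,y,z)\<close> has degree at most the bound of the cell of \<open>z\<close>, and by B4' this bound is
  Lusztig's \<open>a(z)\<close>. The same specialisation in the extremal degree then says that the leading
  matrices multiply with structure constants \<open>\<gamma>\<close>, and they are a basis by B4.\<close>

section \<open>Degrees and specialisation\<close>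

text \<open>In the representation of \<Gamma>, elements outside \<Gamma> may act by nonzero
  matrices, and their structure constants could swamp the degree under study. B1 places such
  elements in cells above \<Gamma>, and B5 makes their bounds at most that of \<Gamma>; hence a
  degree of theirs that is too large for \<Gamma> is too large for their own cell as well. This is
  why the maximum is taken over the violations at all \<open>z\<close> simultaneously. It exists
  because a product of two basis elements has finitely many terms, so the argument needs no
  induction along the cell order. B3 leaves only the terms in \<Gamma> after specialisation.
  Associativity of the asymptotic product is carried over from matrix multiplication along the
  injection given by B4.\<close>

lemma poly_mapping_mult_expand:
  fixes f g :: "'a::comm_monoid_add \<Rightarrow>\<^sub>0 'b::comm_semiring_0"
  shows "f * g = (\<Sum>a\<in>Poly_Mapping.keys f. \<Sum>b\<in>Poly_Mapping.keys g.
    Poly_Mapping.single (a + b) (Poly_Mapping.lookup f a * Poly_Mapping.lookup g b))"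
proof -
  have expand: "h = (\<Sum>a\<in>Poly_Mapping.keys h. Poly_Mapping.single a (Poly_Mapping.lookup h a))"
    for h :: "'a \<Rightarrow>\<^sub>0 'b"
  proof (rule poly_mapping_eqI)
    fix k
    show "Poly_Mapping.lookup h k =
        Poly_Mapping.lookup (\<Sum>a\<in>Poly_Mapping.keys h. Poly_Mapping.single a (Poly_Mapping.lookup h a)) k"
      by (cases "k \<in> Poly_Mapping.keys h")
        (simp_all add: lookup_sum lookup_single when_def in_keys_iff)
  qed
  show ?thesis
    by (subst (1) expand[of f], subst (1) expand[of g])
      (simp add: sum_product mult_single)
qed

text \<open>A coefficient of a product is a finite sum whose terms with exponents not adding up to
  \<open>k\<close> are zero, hence the condition \<open>P 0\<close>. The rule serves both levels of
  \<open>mlaurent\<close>: exponent vectors outside, powers of \<open>q\<close> inside.\<close>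

lemma lookup_mult_cases:
  fixes f g :: "'a::comm_monoid_add \<Rightarrow>\<^sub>0 'b::comm_semiring_0"
  assumes "P 0" and "\<And>x y. P x \<Longrightarrow> P y \<Longrightarrow> P (x + y)"
    and "\<And>a b. k = a + b \<Longrightarrow> P (Poly_Mapping.lookup f a * Poly_Mapping.lookup g b)"
  shows "P (Poly_Mapping.lookup (f * g) k)"
proof -
  have sum: "P (sum h A)" if "\<And>a. a \<in> A \<Longrightarrow> P (h a)" for h and A :: "'a set"
    using that by (induction A rule: infinite_finite_induct) (auto intro: assms)
  show ?thesis
    unfolding poly_mapping_mult_expand[of f g] lookup_sum lookup_single
    by (intro sum) (auto simp: when_def intro: assms)
qed

text \<open>The case \<open>n = 0\<close> is the degree condition of \<open>nonpos_part\<close>,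
  detached from membership in a particular coefficient ring, so that no closure under its operations
  has to be tracked.\<close>

definition qdeg_le :: "int \<Rightarrow> mlaurent \<Rightarrow> bool" where
  "qdeg_le n f \<longleftrightarrow> (\<forall>e. \<forall>k>n. Poly_Mapping.lookup (Poly_Mapping.lookup f e) k = 0)"

lemma qdeg_le_0 [simp]: "qdeg_le n 0"
  and qdeg_le_add: "qdeg_le n f \<Longrightarrow> qdeg_le n g \<Longrightarrow> qdeg_le n (f + g)"
  by (auto simp: qdeg_le_def lookup_add)

lemma qdeg_le_sum: "(\<And>i. i \<in> I \<Longrightarrow> qdeg_le n (f i)) \<Longrightarrow> qdeg_le n (sum f I)"
  by (induction I rule: infinite_finite_induct) (auto intro: qdeg_le_add)

lemma qdeg_le_mult:
  assumes f: "qdeg_le m f" and g: "qdeg_le n g"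
  shows "qdeg_le (m + n) (f * g)"
proof -
  have "\<forall>k>m+n. Poly_Mapping.lookup (Poly_Mapping.lookup (f * g) e) k = 0" for e
  proof (rule lookup_mult_cases[where P = "\<lambda>r. \<forall>k>m+n. Poly_Mapping.lookup r k = 0"])
    fix a b
    show "\<forall>k>m+n. Poly_Mapping.lookup (Poly_Mapping.lookup f a * Poly_Mapping.lookup g b) k = 0"
    proof (intro allI impI)
      fix k assume k: "m + n < k"
      show "Poly_Mapping.lookup (Poly_Mapping.lookup f a * Poly_Mapping.lookup g b) k = 0"
      proof (rule lookup_mult_cases[where P = "\<lambda>r. r = 0"])
        fix i j assume "k = i + j"
        then have "m < i \<or> n < j" using k by linarith
        then show "Poly_Mapping.lookup (Poly_Mapping.lookup f a) i *
            Poly_Mapping.lookup (Poly_Mapping.lookup g b) j = 0"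
          using f g by (auto simp: qdeg_le_def)
      qed simp_all
    qed
  qed (simp_all add: lookup_add)
  then show ?thesis by (simp add: qdeg_le_def)
qed

lemma of_laurent_mult: "of_laurent r * of_laurent s = of_laurent (r * s)"
  by (simp add: of_laurent_def mult_single)

lemma of_laurent_qpow_mult: "of_laurent (qpow m) * of_laurent (qpow n) = of_laurent (qpow (m + n))"
  by (simp add: of_laurent_mult qpow_def mult_single)

lemma lookup_qpow_mult: "Poly_Mapping.lookup (qpow m * r) k = Poly_Mapping.lookup r (k - m)"
proof -
  have shift: "m + b = k \<longleftrightarrow> b = k - m" for b by auto
  have "Poly_Mapping.lookup (qpow m * r) k =
      (\<Sum>b\<in>Poly_Mapping.keys r. Poly_Mapping.lookup r b when b = k - m)"
    unfolding poly_mapping_mult_expand[of "qpow m" r]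
    by (simp add: qpow_def lookup_sum lookup_single when_def shift)
  also have "\<dots> = Poly_Mapping.lookup r (k - m)"
    by (simp add: when_def in_keys_iff)
  finally show ?thesis .
qed

lemma qdeg_le_of_laurent:
  "qdeg_le n (of_laurent r) \<longleftrightarrow> (\<forall>k>n. Poly_Mapping.lookup r k = 0)"
  by (auto simp: qdeg_le_def of_laurent_def lookup_single when_def split: if_splits)

lemma qdeg_le_qpow [simp]: "qdeg_le n (of_laurent (qpow n))"
  by (simp add: qdeg_le_of_laurent qpow_def lookup_single)

section \<open>Multiplicativity of the specialisation\<close>

lemma lookup_sp:
  "Poly_Mapping.lookup (sp f) e = Poly_Mapping.single 0 (Poly_Mapping.lookup (Poly_Mapping.lookup f e) 0)"
  by (simp add: sp_def Poly_Mapping.map.rep_eq when_def)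

lemma sp_0 [simp]: "sp 0 = 0"
  by (rule poly_mapping_eqI) (simp add: lookup_sp)

lemma sp_add: "sp (f + g) = sp f + sp g"
  by (rule poly_mapping_eqI) (simp add: lookup_sp lookup_add single_add)

lemma sp_sum: "sp (sum f I) = (\<Sum>i\<in>I. sp (f i))"
  by (induction I rule: infinite_finite_induct) (simp_all add: sp_add)

lemma sp_diff: "sp (f - g) = sp f - sp g"
  by (rule poly_mapping_eqI) (simp add: lookup_sp lookup_minus single_diff)

lemma sp_eq_0: "qdeg_le n f \<Longrightarrow> n < 0 \<Longrightarrow> sp f = 0"
  by (rule poly_mapping_eqI) (simp add: lookup_sp qdeg_le_def)

lemma qdeg_le_sp: "qdeg_le 0 (sp f)"
  by (simp add: qdeg_le_def lookup_sp lookup_single when_def)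

lemma qdeg_le_diff_sp: "qdeg_le 0 f \<Longrightarrow> qdeg_le (-1) (f - sp f)"
  by (auto simp: qdeg_le_def lookup_minus lookup_sp lookup_single when_def)

text \<open>The fixed points of \<open>sp\<close> are the elements whose coefficients are constant
  in \<open>q\<close>, a property inherited by sums and products.\<close>

lemma sp_sp_mult: "sp (sp f * sp g) = sp f * sp g"
proof (rule poly_mapping_eqI)
  fix e
  let ?Z = "\<lambda>r::laurent. Poly_Mapping.single 0 (Poly_Mapping.lookup r 0) = r"
  have "?Z (Poly_Mapping.lookup (sp f * sp g) e)"
    by (rule lookup_mult_cases)
      (simp_all add: lookup_sp mult_single lookup_add single_add)
  then show "Poly_Mapping.lookup (sp (sp f * sp g)) e = Poly_Mapping.lookup (sp f * sp g) e"
    by (simp add: lookup_sp)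
qed

text \<open>Taking the constant term is not multiplicative in general, as \<open>q\<close> and its
  inverse show. In degrees at most 0, \<open>f\<close> and \<open>sp f\<close> differ only in
  negative degrees, and each term of the decomposition below contains one such difference.\<close>

lemma sp_mult:
  assumes f: "qdeg_le 0 f" and g: "qdeg_le 0 g"
  shows "sp (f * g) = sp f * sp g"
proof -
  have "f * g - sp f * sp g = (f - sp f) * g + sp f * (g - sp g)"
    by (simp add: algebra_simps)
  moreover have "qdeg_le (-1) ((f - sp f) * g + sp f * (g - sp g))"
    using qdeg_le_mult[OF qdeg_le_diff_sp[OF f] g] qdeg_le_mult[OF qdeg_le_sp qdeg_le_diff_sp[OF g]]
    by (auto intro: qdeg_le_add)
  ultimately have "sp (f * g - sp f * sp g) = 0"
    by (simp add: sp_eq_0)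
  then show ?thesis by (simp add: sp_diff sp_sp_mult)
qed

lemma sp_of_laurent: "sp (of_laurent r) = of_int (Poly_Mapping.lookup r 0)"
proof (rule poly_mapping_eqI)
  fix e
  show "Poly_Mapping.lookup (sp (of_laurent r)) e = Poly_Mapping.lookup (of_int (Poly_Mapping.lookup r 0)) e"
    using single_of_int[where 'a = int and 'b = int, of "Poly_Mapping.lookup r 0", symmetric]
    by (simp add: lookup_sp of_laurent_def lookup_of_int lookup_single when_def)
qed

section \<open>Coordinates\<close>

lemma ring_on_simps [simp]:
  "carrier (ring_on A) = A" "x \<otimes>\<^bsub>ring_on A\<^esub> y = x * y" "x \<oplus>\<^bsub>ring_on A\<^esub> y = x + y"
  "\<zero>\<^bsub>ring_on A\<^esub> = 0" "\<one>\<^bsub>ring_on A\<^esub> = 1"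
  by (simp_all add: ring_on_def)

text \<open>Applied to the action in each of its two arguments. That \<phi> preserves zero follows
  by cancellation in the target group.\<close>

lemma additive_finsum:
  assumes "abelian_group M" "abelian_group N"
    and closed: "\<And>x. x \<in> carrier M \<Longrightarrow> \<phi> x \<in> carrier N"
    and add: "\<And>x y. x \<in> carrier M \<Longrightarrow> y \<in> carrier M \<Longrightarrow> \<phi> (x \<oplus>\<^bsub>M\<^esub> y) = \<phi> x \<oplus>\<^bsub>N\<^esub> \<phi> y"
    and "finite J" and "f \<in> J \<rightarrow> carrier M"
  shows "\<phi> (finsum M f J) = finsum N (\<lambda>j. \<phi> (f j)) J"
proof -
  interpret M: abelian_group M by fact
  interpret N: abelian_group N by fact
  have "\<phi> \<zero>\<^bsub>M\<^esub> \<oplus>\<^bsub>N\<^esub> \<phi> \<zero>\<^bsub>M\<^esub> = \<phi> \<zero>\<^bsub>M\<^esub>"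
    using add[of "\<zero>\<^bsub>M\<^esub>" "\<zero>\<^bsub>M\<^esub>"] by simp
  then have zero: "\<phi> \<zero>\<^bsub>M\<^esub> = \<zero>\<^bsub>N\<^esub>"
    using closed[of "\<zero>\<^bsub>M\<^esub>"] N.add.l_cancel_one by auto
  show ?thesis
    using assms(5,6) by (induction rule: finite_induct) (auto simp: zero add closed Pi_iff)
qed

text \<open>The indexed form covers both the Hecke algebra with the family \<open>C\<close> and a
  representation whose basis is a set indexed by itself. Scalars from \<open>ring_on\<close> let
  ring operations simplify to those of the type class.\<close>

locale based_module = module "ring_on A" M for A :: "'a::comm_ring_1 set" and M (structure) +
  fixes I :: "'i set" and b
  assumes basis: "is_basis (ring_on A) M I b"
begin

abbreviation "crd \<equiv> coords (ring_on A) M I b"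

lemma basis_closed: "i \<in> I \<Longrightarrow> b i \<in> carrier M"
  using basis by (auto simp: is_basis_def)

lemma zero_mem: "0 \<in> A" and one_mem: "1 \<in> A"
  and add_mem: "x \<in> A \<Longrightarrow> y \<in> A \<Longrightarrow> x + y \<in> A"
  and mult_mem: "x \<in> A \<Longrightarrow> y \<in> A \<Longrightarrow> x * y \<in> A"
  using R.zero_closed R.one_closed R.add.m_closed[of x y] R.m_closed[of x y] by simp_all

text \<open>The index set of \<open>lin_comb\<close> is the support of \<open>c\<close>. A common
  larger index set allows two combinations to be added term by term.\<close>

lemma lin_comb_superset:
  assumes c: "c \<in> fin_coeffs (ring_on A) I" and J: "finite J" "{i. c i \<noteq> 0} \<subseteq> J" "J \<subseteq> I"
  shows "lin_comb (ring_on A) M b c = (\<Oplus>i\<in>J. c i \<odot> b i)"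
proof -
  have mem: "c i \<in> A" for i using c by (simp add: fin_coeffs_def)
  show ?thesis
    unfolding lin_comb_def ring_on_simps
  proof (rule M.add.finprod_mono_neutral_cong_left[OF J(1,2)])
    show "c i \<odot> b i = \<zero>" if "i \<in> J - {i. c i \<noteq> 0}" for i
      using that J(3) basis_closed smult_l_null by auto
  qed (use J(3) basis_closed mem in auto)
qed

lemma coords_eqI:
  assumes "c \<in> fin_coeffs (ring_on A) I" "x = lin_comb (ring_on A) M b c" "x \<in> carrier M"
  shows "crd x = c"
  unfolding coords_def using basis assms by (intro the1_equality) (auto simp: is_basis_def)

lemma coords_lin_comb:
  assumes "x \<in> carrier M"
  shows "crd x \<in> fin_coeffs (ring_on A) I" "x = lin_comb (ring_on A) M b (crd x)"
proof -
  have "\<exists>!c. c \<in> fin_coeffs (ring_on A) I \<and> x = lin_comb (ring_on A) M b c"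
    using basis assms by (simp add: is_basis_def)
  from theI'[OF this] show "crd x \<in> fin_coeffs (ring_on A) I" "x = lin_comb (ring_on A) M b (crd x)"
    by (auto simp: coords_def)
qed

lemma coords_mem: "x \<in> carrier M \<Longrightarrow> crd x i \<in> A"
  and finite_coords: "x \<in> carrier M \<Longrightarrow> finite {i. crd x i \<noteq> 0}"
  and coords_outside: "x \<in> carrier M \<Longrightarrow> crd x i \<noteq> 0 \<Longrightarrow> i \<in> I"
  using coords_lin_comb(1)[of x] by (auto simp: fin_coeffs_def)

lemma expand_coords: "x \<in> carrier M \<Longrightarrow> x = (\<Oplus>i\<in>{i. crd x i \<noteq> 0}. crd x i \<odot> b i)"
  using coords_lin_comb(2)[of x] by (simp add: lin_comb_def)

lemma coords_finsum_eqI: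
  assumes "finite J" "J \<subseteq> I" "\<And>i. c i \<in> A" "\<And>i. i \<notin> J \<Longrightarrow> c i = 0"
  shows "crd (\<Oplus>i\<in>J. c i \<odot> b i) = c"
proof (rule coords_eqI)
  have sub: "{i. c i \<noteq> 0} \<subseteq> J" using assms by auto
  show c: "c \<in> fin_coeffs (ring_on A) I"
    using sub assms by (auto simp: fin_coeffs_def dest: finite_subset)
  show "(\<Oplus>i\<in>J. c i \<odot> b i) = lin_comb (ring_on A) M b c"
    using lin_comb_superset[OF c assms(1) sub assms(2)] by simp
  show "(\<Oplus>i\<in>J. c i \<odot> b i) \<in> carrier M"
    using assms basis_closed by (intro M.finsum_closed) auto
qed

lemma coords_add:
  assumes x: "x \<in> carrier M" and y: "y \<in> carrier M"
  shows "crd (x \<oplus> y) = (\<lambda>i. crd x i + crd y i)"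
proof -
  define J where "J = {i. crd x i \<noteq> 0} \<union> {i. crd y i \<noteq> 0}"
  have J: "finite J" "J \<subseteq> I"
    using x y finite_coords coords_outside by (auto simp: J_def)
  have ex: "z = (\<Oplus>i\<in>J. crd z i \<odot> b i)" if "z \<in> carrier M" "{i. crd z i \<noteq> 0} \<subseteq> J" for z
    using coords_lin_comb[OF that(1)] lin_comb_superset J that(2) by metis
  have "x \<oplus> y = (\<Oplus>i\<in>J. crd x i \<odot> b i) \<oplus> (\<Oplus>i\<in>J. crd y i \<odot> b i)"
    using ex[OF x] ex[OF y] by (simp add: J_def)
  also have "\<dots> = (\<Oplus>i\<in>J. crd x i \<odot> b i \<oplus> crd y i \<odot> b i)"
    using x y J basis_closed coords_mem by (subst M.finsum_addf) auto
  also have "\<dots> = (\<Oplus>i\<in>J. (crd x i + crd y i) \<odot> b i)"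
    using x y J basis_closed coords_mem smult_l_distr
    by (intro M.finsum_cong') (auto simp: subset_iff add_mem)
  also have "crd \<dots> = (\<lambda>i. crd x i + crd y i)"
    by (rule coords_finsum_eqI) (use J x y coords_mem add_mem in \<open>auto simp: J_def\<close>)
  finally show ?thesis .
qed

lemma coords_smult:
  assumes x: "x \<in> carrier M" and a: "a \<in> A"
  shows "crd (a \<odot> x) = (\<lambda>i. a * crd x i)"
proof -
  define J where "J = {i. crd x i \<noteq> 0}"
  have J: "finite J" "J \<subseteq> I"
    using x finite_coords coords_outside by (auto simp: J_def)
  have "a \<odot> x = a \<odot> (\<Oplus>i\<in>J. crd x i \<odot> b i)"
    using expand_coords[OF x] by (simp add: J_def)
  also have "\<dots> = (\<Oplus>i\<in>J. a \<odot> (crd x i \<odot> b i))"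
    using x a J basis_closed coords_mem by (intro finsum_smult_ldistr) auto
  also have "\<dots> = (\<Oplus>i\<in>J. (a * crd x i) \<odot> b i)"
    using x a J basis_closed coords_mem smult_assoc1
    by (intro M.finsum_cong') (auto simp: subset_iff mult_mem)
  also have "crd \<dots> = (\<lambda>i. a * crd x i)"
    by (rule coords_finsum_eqI) (use J x a coords_mem mult_mem in \<open>auto simp: J_def\<close>)
  finally show ?thesis .
qed

lemma coords_zero: "crd \<zero> = (\<lambda>i. 0)"
  using coords_smult[OF M.zero_closed zero_mem] smult_l_null[OF M.zero_closed] by simp

lemma coords_finsum:
  assumes "finite J" "f \<in> J \<rightarrow> carrier M"
  shows "crd (finsum M f J) i = (\<Sum>j\<in>J. crd (f j) i)"
  using assms by (induction rule: finite_induct) (auto simp: coords_zero coords_add Pi_iff M.finsum_closed)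

text \<open>Supplies the nonzero coordinate behind reflexivity of the cell preorder.\<close>

lemma coords_basis:
  assumes "i \<in> I"
  shows "crd (b i) i = 1"
proof -
  have "crd (\<Oplus>j\<in>{i}. (if j = i then 1 else 0) \<odot> b j) = (\<lambda>j. if j = i then 1 else 0)"
    by (rule coords_finsum_eqI) (use assms zero_mem one_mem in auto)
  moreover have "(\<Oplus>j\<in>{i}. (if j = i then 1 else 0) \<odot> b j) = b i"
    using assms basis_closed smult_one by (subst M.finsum_insert) auto
  ultimately show ?thesis by simp
qed

end

section \<open>Matrix representations\<close>

lemma of_laurent_mem: "is_rpoly_ring A \<Longrightarrow> of_laurent r \<in> carrier A"
  by (auto simp: is_rpoly_ring_def rpoly_ring_def of_laurent_def)

lemma ring_on_carrier_rpoly_ring: "is_rpoly_ring A \<Longrightarrow> ring_on (carrier A) = A"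
  by (auto simp: is_rpoly_ring_def rpoly_ring_def)

locale hecke_rep =
  fixes G :: "('w, 'b) monoid_scheme" and H :: "(laurent, 'h) module" and C :: "'w \<Rightarrow> 'h"
    and \<rho> :: "('h, 'm) matrix_rep"
  assumes ring_H: "ring H" and module_H: "Module.module laurent_ring H"
    and basis_C: "is_basis laurent_ring H (carrier G) C"
    and rep: "matrix_representation H \<rho>"
begin

abbreviation "A \<equiv> rep_ring \<rho>"
abbreviation "M \<equiv> rep_module \<rho>"
abbreviation "act \<equiv> rep_act \<rho>"
abbreviation "\<P> w \<equiv> rep_matrix \<rho> (C w)"

lemma A_eq: "ring_on (carrier A) = A" and module_M: "Module.module A M"
  and basis_M: "is_basis A M (rep_basis \<rho>) (\<lambda>v. v)"
  and of_laurent_A: "of_laurent r \<in> carrier A"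
  using rep ring_on_carrier_rpoly_ring[of A] of_laurent_mem[of A r]
  unfolding matrix_representation_def Let_def by blast+

sublocale H: ring H by (fact ring_H)

sublocale HC: based_module UNIV H "carrier G" C
  using module_H basis_C by (auto simp: based_module_def based_module_axioms_def laurent_ring_def)

sublocale M: based_module "carrier A" M "rep_basis \<rho>" "\<lambda>v. v"
  using module_M basis_M by (auto simp: based_module_def based_module_axioms_def A_eq)

lemma act_closed: "u \<in> carrier M \<Longrightarrow> h \<in> carrier H \<Longrightarrow> act u h \<in> carrier M"
  and act_add_left: "u \<in> carrier M \<Longrightarrow> v \<in> carrier M \<Longrightarrow> h \<in> carrier H \<Longrightarrow>
    act (u \<oplus>\<^bsub>M\<^esub> v) h = act u h \<oplus>\<^bsub>M\<^esub> act v h"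
  and act_smult_left: "u \<in> carrier M \<Longrightarrow> h \<in> carrier H \<Longrightarrow> a \<in> carrier A \<Longrightarrow>
    act (a \<odot>\<^bsub>M\<^esub> u) h = a \<odot>\<^bsub>M\<^esub> act u h"
  and act_add_right: "u \<in> carrier M \<Longrightarrow> h \<in> carrier H \<Longrightarrow> h' \<in> carrier H \<Longrightarrow>
    act u (h \<oplus>\<^bsub>H\<^esub> h') = act u h \<oplus>\<^bsub>M\<^esub> act u h'"
  and act_mult: "u \<in> carrier M \<Longrightarrow> h \<in> carrier H \<Longrightarrow> h' \<in> carrier H \<Longrightarrow>
    act u (h \<otimes>\<^bsub>H\<^esub> h') = act (act u h) h'"
  and act_smult_right: "u \<in> carrier M \<Longrightarrow> h \<in> carrier H \<Longrightarrow>
    act u (r \<odot>\<^bsub>H\<^esub> h) = of_laurent r \<odot>\<^bsub>M\<^esub> act u h"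
  using rep unfolding matrix_representation_def Let_def by blast+

lemma rep_matrix_eq:
  "u \<in> rep_basis \<rho> \<Longrightarrow> rep_matrix \<rho> h u v = M.crd (act u h) v"
  by (simp add: rep_matrix_def A_eq)

lemma finite_row:
  assumes "h \<in> carrier H"
  shows "finite {t. rep_matrix \<rho> h u t \<noteq> 0}"
proof (cases "u \<in> rep_basis \<rho>")
  case True
  then show ?thesis
    using M.finite_coords[OF act_closed[OF M.basis_closed assms]] by (simp add: rep_matrix_eq)
qed (simp add: rep_matrix_def)

lemma row_outside:
  assumes "h \<in> carrier H" "rep_matrix \<rho> h u t \<noteq> 0"
  shows "t \<in> rep_basis \<rho>"
proof -
  have u: "u \<in> rep_basis \<rho>" using assms(2) by (simp add: rep_matrix_def split: if_splits)
  show ?thesis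
    using assms M.coords_outside[OF act_closed[OF M.basis_closed[OF u] assms(1)]] u
    by (simp add: rep_matrix_eq)
qed

text \<open>Row \<open>u\<close> holds the coordinates of \<open>act u h\<close>, and the action is
  on the right, so the order of the factors is preserved.\<close>

lemma rep_matrix_mult:
  assumes h: "h \<in> carrier H" and h': "h' \<in> carrier H"
  shows "rep_matrix \<rho> (h \<otimes>\<^bsub>H\<^esub> h') u v =
    (\<Sum>t | rep_matrix \<rho> h u t \<noteq> 0. rep_matrix \<rho> h u t * rep_matrix \<rho> h' t v)"
proof (cases "u \<in> rep_basis \<rho>")
  case u: True
  let ?c = "rep_matrix \<rho> h u"
  let ?J = "{t. ?c t \<noteq> 0}"
  have uM: "u \<in> carrier M" by (rule M.basis_closed[OF u])
  have J: "t \<in> rep_basis \<rho>" "t \<in> carrier M" if "t \<in> ?J" for t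
    using row_outside[OF h] M.basis_closed that by auto
  have c: "?c t \<in> carrier A" for t
    using M.coords_mem[OF act_closed[OF uM h]] u by (simp add: rep_matrix_eq)
  have "act u (h \<otimes>\<^bsub>H\<^esub> h') = act (act u h) h'"
    using act_mult uM h h' by simp
  \<comment> \<open>Only the outer occurrence of \<open>act u h\<close> is expanded; the
    coefficients \<open>?c\<close> contain it too, so the congruence is applied at a fixed
    place.\<close>
  also have "\<dots> = act (finsum M (\<lambda>t. ?c t \<odot>\<^bsub>M\<^esub> t) ?J) h'"
    unfolding rep_matrix_eq[OF u]
    by (rule arg_cong[where f = "\<lambda>m. act m h'", OF M.expand_coords[OF act_closed[OF uM h]]])
  also have "\<dots> = finsum M (\<lambda>t. act (?c t \<odot>\<^bsub>M\<^esub> t) h') ?J"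
  proof (rule additive_finsum[where \<phi> = "\<lambda>m. act m h'"])
    show "(\<lambda>t. ?c t \<odot>\<^bsub>M\<^esub> t) \<in> ?J \<rightarrow> carrier M"
      using J c M.smult_closed by auto
  qed (use h' in \<open>auto intro: M.M.abelian_group_axioms act_closed act_add_left finite_row h\<close>)
  also have "M.crd \<dots> v = (\<Sum>t\<in>?J. M.crd (act (?c t \<odot>\<^bsub>M\<^esub> t) h') v)"
    using J c M.smult_closed h h' by (intro M.coords_finsum) (auto intro: finite_row act_closed)
  also have "\<dots> = (\<Sum>t\<in>?J. ?c t * rep_matrix \<rho> h' t v)"
    using J c h' by (intro sum.cong) (auto simp: act_smult_left M.coords_smult act_closed rep_matrix_eq)
  finally show ?thesis using u by (simp add: rep_matrix_eq)
qed (simp add: rep_matrix_def)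

lemma rep_matrix_expand:
  assumes h: "h \<in> carrier H"
  shows "rep_matrix \<rho> h u v = (\<Sum>w | HC.crd h w \<noteq> 0. of_laurent (HC.crd h w) * \<P> w u v)"
proof (cases "u \<in> rep_basis \<rho>")
  case u: True
  let ?J = "{w. HC.crd h w \<noteq> 0}"
  have uM: "u \<in> carrier M" by (rule M.basis_closed[OF u])
  have J: "C w \<in> carrier H" if "w \<in> ?J" for w
    using HC.coords_outside[OF h] HC.basis_closed that by auto
  have "act u h = act u (finsum H (\<lambda>w. HC.crd h w \<odot>\<^bsub>H\<^esub> C w) ?J)"
    by (rule arg_cong[where f = "act u", OF HC.expand_coords[OF h]])
  also have "\<dots> = finsum M (\<lambda>w. act u (HC.crd h w \<odot>\<^bsub>H\<^esub> C w)) ?J"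
  proof (rule additive_finsum)
    show "(\<lambda>w. HC.crd h w \<odot>\<^bsub>H\<^esub> C w) \<in> ?J \<rightarrow> carrier H"
      using J HC.smult_closed by auto
  qed (use uM in \<open>auto intro: M.M.abelian_group_axioms H.abelian_group_axioms act_closed
        act_add_right HC.finite_coords h\<close>)
  also have "M.crd \<dots> v = (\<Sum>w\<in>?J. M.crd (act u (HC.crd h w \<odot>\<^bsub>H\<^esub> C w)) v)"
    using J HC.smult_closed h uM
    by (intro M.coords_finsum) (auto intro: HC.finite_coords act_closed)
  also have "\<dots> = (\<Sum>w\<in>?J. of_laurent (HC.crd h w) * \<P> w u v)"
    using J uM u
    by (intro sum.cong) (auto simp: act_smult_right M.coords_smult act_closed rep_matrix_eq of_laurent_A)
  finally show ?thesis using u by (simp add: rep_matrix_eq)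
qed (simp add: rep_matrix_def)

section \<open>Kazhdan--Lusztig structure constants in a representation\<close>

lemma C_closed: "w \<in> carrier G \<Longrightarrow> C w \<in> carrier H"
  by (rule HC.basis_closed)

lemma kl_struct_eq: "kl_struct G H C x y z = HC.crd (C x \<otimes>\<^bsub>H\<^esub> C y) z"
  by (simp add: kl_struct_def laurent_ring_def)

lemma finite_kl_struct:
  "x \<in> carrier G \<Longrightarrow> y \<in> carrier G \<Longrightarrow> finite {z. kl_struct G H C x y z \<noteq> 0}"
  by (simp add: kl_struct_eq HC.finite_coords C_closed)

lemma kl_struct_outside:
  "x \<in> carrier G \<Longrightarrow> y \<in> carrier G \<Longrightarrow> kl_struct G H C x y z \<noteq> 0 \<Longrightarrow> z \<in> carrier G"
  unfolding kl_struct_eq by (rule HC.coords_outside) (simp_all add: C_closed)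

lemma kl_matrix_mult:
  assumes "x \<in> carrier G" "y \<in> carrier G"
  shows "(\<Sum>t | \<P> x u t \<noteq> 0. \<P> x u t * \<P> y t v) =
    (\<Sum>w | kl_struct G H C x y w \<noteq> 0. of_laurent (kl_struct G H C x y w) * \<P> w u v)"
  using rep_matrix_mult[of "C x" "C y" u v] rep_matrix_expand[of "C x \<otimes>\<^bsub>H\<^esub> C y" u v] assms
  by (simp add: kl_struct_eq C_closed)

section \<open>Leading matrices\<close>

abbreviation "\<a> \<equiv> int (rep_bound G C \<rho>)"
abbreviation "\<c> \<equiv> leading_matrix G C \<rho>"

lemma leading_matrix_row_subset: "{t. \<c> w u t \<noteq> 0} \<subseteq> {t. \<P> w u t \<noteq> 0}"
  by (auto simp: leading_matrix_def)

lemma finite_leading_matrix_row: "w \<in> carrier G \<Longrightarrow> finite {t. \<c> w u t \<noteq> 0}"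
  using finite_subset[OF leading_matrix_row_subset finite_row] C_closed by blast

context
  assumes bounded: "bounded_rep G C \<rho>"
begin

text \<open>Boundedness speaks of entries indexed by the basis; all other entries are zero, so the
  estimate extends to every \<open>u\<close> and \<open>v\<close>.\<close>

lemma qdeg_le_scaled_rep_matrix:
  assumes "w \<in> carrier G"
  shows "qdeg_le 0 (of_laurent (qpow (- \<a>)) * \<P> w u v)"
proof (cases "u \<in> rep_basis \<rho> \<and> v \<in> rep_basis \<rho>")
  case True
  have "bounded_by G C \<rho> (rep_bound G C \<rho>)"
    using bounded unfolding bounded_rep_def rep_bound_def by (rule LeastI_ex)
  then have "of_laurent (qpow (- \<a>)) * \<P> w u v \<in> nonpos_part A"
    using True assms by (simp add: bounded_by_def)
  then show ?thesis by (simp add: nonpos_part_def nonpos_laurent_def qdeg_le_def)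
next
  case False
  then have "\<P> w u v = 0"
    using row_outside[OF C_closed[OF assms], of u v] unfolding rep_matrix_def by meson
  then show ?thesis by simp
qed

text \<open>The product \<open>\<P> x \<P> y = (\<Sum>w. h(x,y,w) \<P> w)\<close> is multiplied by \<open>q\<close> to the power \<open>- \<a> - N\<close> and
  specialised; the left-hand side vanishes unless \<open>N = \<a>\<close>.\<close>

lemma specialised_product:
  assumes x: "x \<in> carrier G" and y: "y \<in> carrier G" and N: "\<a> \<le> N"
    and deg: "\<And>w k. \<P> w \<noteq> (\<lambda>u v. 0) \<Longrightarrow> N < k \<Longrightarrow> Poly_Mapping.lookup (kl_struct G H C x y w) k = 0"
  shows "(\<Sum>w | kl_struct G H C x y w \<noteq> 0.
      of_int (Poly_Mapping.lookup (kl_struct G H C x y w) N) * \<c> w u v) =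
    (if N = \<a> then \<Sum>t | \<c> x u t \<noteq> 0. \<c> x u t * \<c> y t v else 0)"
proof -
  let ?h = "kl_struct G H C x y"
  let ?Q = "\<lambda>n. of_laurent (qpow n)"
  let ?R = "\<lambda>w u v. ?Q (- \<a>) * \<P> w u v"
  have R: "qdeg_le 0 (?R w u v)" if "w \<in> carrier G" for w u v
    using qdeg_le_scaled_rep_matrix[OF that] .
  have spR: "sp (?R w u v) = \<c> w u v" for w u v by (simp add: leading_matrix_def)
  have deg_RR: "qdeg_le 0 (\<Sum>t | \<P> x u t \<noteq> 0. ?R x u t * ?R y t v)"
    using qdeg_le_mult[OF R R, OF x y] by (intro qdeg_le_sum) simp
  \<comment> \<open>If \<open>\<P> w\<close> is nonzero, \<open>deg\<close> puts both factors in
    degree at most 0 and \<open>sp_mult\<close> applies. If it is zero, nothing is known about the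
    degree of \<open>?h w\<close>, but both sides vanish.\<close>
  have *: "sp (?Q (- N) * of_laurent (?h w) * ?R w u v) =
      of_int (Poly_Mapping.lookup (?h w) N) * \<c> w u v" if "?h w \<noteq> 0" for w
  proof (cases "\<P> w = (\<lambda>u v. 0)")
    case True
    then show ?thesis by (simp add: leading_matrix_def)
  next
    case False
    have w: "w \<in> carrier G" using kl_struct_outside[OF x y that] .
    have "qdeg_le 0 (of_laurent (qpow (- N) * ?h w))"
      using deg[OF False] by (simp add: qdeg_le_of_laurent lookup_qpow_mult)
    from sp_mult[OF this R[OF w]] show ?thesis
      by (simp add: of_laurent_mult spR sp_of_laurent lookup_qpow_mult)
  qed
  have "(\<Sum>w | ?h w \<noteq> 0. of_int (Poly_Mapping.lookup (?h w) N) * \<c> w u v) =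
      sp (\<Sum>w | ?h w \<noteq> 0. ?Q (- N) * of_laurent (?h w) * ?R w u v)"
    unfolding sp_sum using * by (intro sum.cong) simp_all
  also have "(\<Sum>w | ?h w \<noteq> 0. ?Q (- N) * of_laurent (?h w) * ?R w u v) =
      ?Q (- N) * ?Q (- \<a>) * (\<Sum>w | ?h w \<noteq> 0. of_laurent (?h w) * \<P> w u v)"
    by (simp add: sum_distrib_left mult_ac)
  also have "\<dots> = ?Q (- N) * ?Q (- \<a>) * (\<Sum>t | \<P> x u t \<noteq> 0. \<P> x u t * \<P> y t v)"
    using kl_matrix_mult[OF x y] by simp
  \<comment> \<open>Each of the two matrices absorbs one power \<open>- \<a>\<close>. The remaining
    exponent \<open>\<a> - N\<close> is nonpositive and is 0 exactly when
    \<open>N = \<a>\<close>.\<close>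
  also have "?Q (- N) = ?Q (\<a> - N) * ?Q (- \<a>)"
    by (simp add: of_laurent_qpow_mult)
  also have "?Q (\<a> - N) * ?Q (- \<a>) * ?Q (- \<a>) * (\<Sum>t | \<P> x u t \<noteq> 0. \<P> x u t * \<P> y t v) =
      ?Q (\<a> - N) * (\<Sum>t | \<P> x u t \<noteq> 0. ?R x u t * ?R y t v)"
    by (simp add: sum_distrib_left mult_ac)
  also have "sp \<dots> = (if N = \<a> then \<Sum>t | \<c> x u t \<noteq> 0. \<c> x u t * \<c> y t v else 0)"
  proof (cases "N = \<a>")
    case True
    have "?Q 0 = 1" by (simp add: qpow_def of_laurent_def)
    then have "sp (?Q (\<a> - N) * (\<Sum>t | \<P> x u t \<noteq> 0. ?R x u t * ?R y t v)) =
        (\<Sum>t | \<P> x u t \<noteq> 0. sp (?R x u t * ?R y t v))"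
      using True by (simp add: sp_sum)
    also have "\<dots> = (\<Sum>t | \<P> x u t \<noteq> 0. \<c> x u t * \<c> y t v)"
      using R x y by (intro sum.cong) (simp_all add: sp_mult spR)
    also have "\<dots> = (\<Sum>t | \<c> x u t \<noteq> 0. \<c> x u t * \<c> y t v)"
      using x by (intro sum.mono_neutral_right finite_row C_closed leading_matrix_row_subset) auto
    finally show ?thesis using True by simp
  next
    case False
    then have "\<a> - N < 0" using N by simp
    moreover have "qdeg_le (\<a> - N + 0) (?Q (\<a> - N) * (\<Sum>t | \<P> x u t \<noteq> 0. ?R x u t * ?R y t v))"
      by (rule qdeg_le_mult[OF qdeg_le_qpow deg_RR])
    ultimately show ?thesis using False by (simp add: sp_eq_0)
  qed
  finally show ?thesis .
qed

end

end

section \<open>Rings spanned by matrices with given structure constants\<close>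

text \<open>For infinite bases this keeps the matrix product meaningful: a \<open>sum\<close> over
  an infinite set defaults to 0.\<close>

definition row_finite :: "('m \<Rightarrow> 'm \<Rightarrow> 'r::zero) \<Rightarrow> bool" where
  "row_finite A \<longleftrightarrow> (\<forall>u. finite {t. A u t \<noteq> 0})"

definition mat_mult :: "('m \<Rightarrow> 'm \<Rightarrow> 'r::comm_ring_1) \<Rightarrow> ('m \<Rightarrow> 'm \<Rightarrow> 'r) \<Rightarrow> 'm \<Rightarrow> 'm \<Rightarrow> 'r" where
  "mat_mult A B u v = (\<Sum>t | A u t \<noteq> 0. A u t * B t v)"

lemma mat_mult_superset:
  assumes "finite J" "{t. A u t \<noteq> 0} \<subseteq> J"
  shows "mat_mult A B u v = (\<Sum>t\<in>J. A u t * B t v)"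
  unfolding mat_mult_def by (rule sum.mono_neutral_left) (use assms in auto)

lemma mat_mult_row_subset: "{t. mat_mult A B u t \<noteq> 0} \<subseteq> (\<Union>s\<in>{s. A u s \<noteq> 0}. {t. B s t \<noteq> 0})"
  by (auto simp: mat_mult_def elim!: sum.not_neutral_contains_not_neutral)

lemma mat_mult_assoc:
  assumes "row_finite A" "row_finite B"
  shows "mat_mult (mat_mult A B) C = mat_mult A (mat_mult B C)"
proof (intro ext)
  fix u v
  define K where "K = {s. A u s \<noteq> 0}"
  \<comment> \<open>A finite set containing the support of row \<open>u\<close> of the product and
    of every row of \<open>B\<close> met from row \<open>u\<close> of \<open>A\<close>, so both
    bracketings become double sums over \<open>K\<close> and \<open>J\<close>.\<close>
  define J where "J = (\<Union>s\<in>K. {t. B s t \<noteq> 0})"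
  have K: "finite K" and J: "finite J"
    using assms by (auto simp: row_finite_def K_def J_def)
  have "mat_mult (mat_mult A B) C u v = (\<Sum>t\<in>J. (\<Sum>s\<in>K. A u s * B s t) * C t v)"
    using mat_mult_row_subset[of A B u] J
    by (subst mat_mult_superset[of J]) (simp_all add: J_def K_def mat_mult_def)
  also have "\<dots> = (\<Sum>s\<in>K. A u s * (\<Sum>t\<in>J. B s t * C t v))"
    unfolding sum_distrib_right sum_distrib_left by (subst sum.swap) (simp add: mult.assoc)
  also have "\<dots> = (\<Sum>s\<in>K. A u s * mat_mult B C s v)"
  proof (intro sum.cong refl)
    fix s assume "s \<in> K"
    then show "A u s * (\<Sum>t\<in>J. B s t * C t v) = A u s * mat_mult B C s v"
      using J by (subst mat_mult_superset[of J B s]) (auto simp: J_def)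
  qed
  finally show "mat_mult (mat_mult A B) C u v = mat_mult A (mat_mult B C) u v"
    by (simp add: K_def mat_mult_def)
qed

lemma mat_mult_add_left:
  assumes "row_finite A" "row_finite B"
  shows "mat_mult (\<lambda>u v. A u v + B u v) C = (\<lambda>u v. mat_mult A C u v + mat_mult B C u v)"
proof (intro ext)
  fix u v
  define J where "J = {t. A u t \<noteq> 0} \<union> {t. B u t \<noteq> 0}"
  have J: "finite J" using assms by (simp add: J_def row_finite_def)
  have *: "mat_mult X C u v = (\<Sum>t\<in>J. X u t * C t v)" if "{t. X u t \<noteq> 0} \<subseteq> J" for X
    using J that by (rule mat_mult_superset)
  show "mat_mult (\<lambda>u v. A u v + B u v) C u v = mat_mult A C u v + mat_mult B C u v"
    by (subst (1 2 3) *) (auto simp: J_def distrib_right sum.distrib)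
qed

lemma mat_mult_add_right:
  "mat_mult A (\<lambda>u v. B u v + C u v) = (\<lambda>u v. mat_mult A B u v + mat_mult A C u v)"
  by (intro ext) (simp add: mat_mult_def distrib_left sum.distrib)

section \<open>Integer combinations of matrices\<close>

lemma int_lin_comb_superset:
  assumes "finite J" "{w. f w \<noteq> 0} \<subseteq> J"
  shows "int_lin_comb X f u v = (\<Sum>w\<in>J. of_int (f w) * X w u v)"
  unfolding int_lin_comb_def by (rule sum.mono_neutral_left) (use assms in auto)

lemma int_lin_comb_row_subset:
  "{t. int_lin_comb X f u t \<noteq> 0} \<subseteq> (\<Union>w\<in>{w. f w \<noteq> 0}. {t. X w u t \<noteq> 0})"
  by (auto simp: int_lin_comb_def elim!: sum.not_neutral_contains_not_neutral)

lemma int_combs_add: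
  assumes "f \<in> int_combs \<Gamma>" "g \<in> int_combs \<Gamma>"
  shows "(\<lambda>w. f w + g w) \<in> int_combs \<Gamma>"
proof -
  have "{w. f w + g w \<noteq> 0} \<subseteq> {w. f w \<noteq> 0} \<union> {w. g w \<noteq> 0}" by auto
  moreover have "finite ({w. f w \<noteq> 0} \<union> {w. g w \<noteq> 0})" "{w. f w \<noteq> 0} \<union> {w. g w \<noteq> 0} \<subseteq> \<Gamma>"
    using assms by (auto simp: int_combs_def)
  ultimately show ?thesis
    unfolding int_combs_def by (blast intro: finite_subset)
qed

lemma int_combs_uminus: "f \<in> int_combs \<Gamma> \<Longrightarrow> (\<lambda>w. - f w) \<in> int_combs \<Gamma>"
  by (simp add: int_combs_def)

lemma int_combs_0: "(\<lambda>w. 0) \<in> int_combs \<Gamma>"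
  by (simp add: int_combs_def)

lemma int_lin_comb_add:
  assumes "f \<in> int_combs \<Gamma>" "g \<in> int_combs \<Gamma>"
  shows "int_lin_comb X (\<lambda>w. f w + g w) = (\<lambda>u v. int_lin_comb X f u v + int_lin_comb X g u v)"
proof (intro ext)
  fix u v
  define J where "J = {w. f w \<noteq> 0} \<union> {w. g w \<noteq> 0}"
  have J: "finite J" using assms by (simp add: J_def int_combs_def)
  have *: "int_lin_comb X h u v = (\<Sum>w\<in>J. of_int (h w) * X w u v)" if "{w. h w \<noteq> 0} \<subseteq> J" for h
    using J that by (rule int_lin_comb_superset)
  show "int_lin_comb X (\<lambda>w. f w + g w) u v = int_lin_comb X f u v + int_lin_comb X g u v"
    by (subst (1 2 3) *) (auto simp: J_def distrib_right sum.distrib)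
qed

lemma int_lin_comb_uminus: "int_lin_comb X (\<lambda>w. - f w) = (\<lambda>u v. - int_lin_comb X f u v)"
  by (intro ext) (simp add: int_lin_comb_def sum_negf)

definition matrix_span :: "('w \<Rightarrow> 'm \<Rightarrow> 'm \<Rightarrow> mlaurent) \<Rightarrow> 'w set \<Rightarrow> ('m \<Rightarrow> 'm \<Rightarrow> mlaurent) rng" where
  "matrix_span X \<Gamma> =
     \<lparr>carrier = int_lin_comb X ` int_combs \<Gamma>, rng_zero = (\<lambda>u v. 0),
      rng_add = (\<lambda>A B u v. A u v + B u v), rng_mult = mat_mult\<rparr>"

definition struct_mult :: "('w \<Rightarrow> 'w \<Rightarrow> 'w \<Rightarrow> int) \<Rightarrow> ('w \<Rightarrow> int) \<Rightarrow> ('w \<Rightarrow> int) \<Rightarrow> 'w \<Rightarrow> int" where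
  "struct_mult c f g z = (\<Sum>x | f x \<noteq> 0. \<Sum>y | g y \<noteq> 0. f x * g y * c x y z)"

text \<open>The shape of \<open>asymptotic_algebra\<close>, with its case distinction on
  \<open>z \<in> \<Gamma>\<close> moved into the constants \<open>c\<close>, which are to vanish
  outside \<Gamma>.\<close>

definition struct_rng :: "'w set \<Rightarrow> ('w \<Rightarrow> 'w \<Rightarrow> 'w \<Rightarrow> int) \<Rightarrow> ('w \<Rightarrow> int) rng" where
  "struct_rng \<Gamma> c =
     \<lparr>carrier = int_combs \<Gamma>, rng_zero = (\<lambda>w. 0), rng_add = (\<lambda>f g w. f w + g w),
      rng_mult = struct_mult c\<rparr>"

text \<open>Separates the pure algebra from the cells: independent matrices whose pairwise products
  are integer combinations of the family.\<close>

locale matrix_structure_constants =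
  fixes X :: "'w \<Rightarrow> 'm \<Rightarrow> 'm \<Rightarrow> mlaurent" and \<Gamma> :: "'w set" and c :: "'w \<Rightarrow> 'w \<Rightarrow> 'w \<Rightarrow> int"
  assumes row_finite_X: "w \<in> \<Gamma> \<Longrightarrow> row_finite (X w)"
    and c_mem: "x \<in> \<Gamma> \<Longrightarrow> y \<in> \<Gamma> \<Longrightarrow> c x y \<in> int_combs \<Gamma>"
    and mult_X: "x \<in> \<Gamma> \<Longrightarrow> y \<in> \<Gamma> \<Longrightarrow> mat_mult (X x) (X y) = int_lin_comb X (c x y)"
    and independent: "f \<in> int_combs \<Gamma> \<Longrightarrow> int_lin_comb X f = (\<lambda>u v. 0) \<Longrightarrow> f = (\<lambda>w. 0)"
begin

abbreviation "\<iota> \<equiv> int_lin_comb X"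

lemma row_finite_comb: "f \<in> int_combs \<Gamma> \<Longrightarrow> row_finite (\<iota> f)"
  unfolding row_finite_def
proof
  fix u assume "f \<in> int_combs \<Gamma>"
  then have "finite (\<Union>w\<in>{w. f w \<noteq> 0}. {t. X w u t \<noteq> 0})"
    using row_finite_X by (auto simp: int_combs_def row_finite_def)
  then show "finite {t. \<iota> f u t \<noteq> 0}"
    by (rule finite_subset[OF int_lin_comb_row_subset])
qed

lemma struct_mult_support:
  "{z. struct_mult c f g z \<noteq> 0} \<subseteq> (\<Union>x\<in>{x. f x \<noteq> 0}. \<Union>y\<in>{y. g y \<noteq> 0}. {z. c x y z \<noteq> 0})"
  by (auto simp: struct_mult_def elim!: sum.not_neutral_contains_not_neutral) (metis mult_eq_0_iff)

lemma finite_struct_support: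
  assumes "f \<in> int_combs \<Gamma>" "g \<in> int_combs \<Gamma>"
  shows "finite (\<Union>x\<in>{x. f x \<noteq> 0}. \<Union>y\<in>{y. g y \<noteq> 0}. {z. c x y z \<noteq> 0})"
  using assms c_mem by (auto simp: int_combs_def subset_iff)

lemma struct_mult_mem:
  assumes "f \<in> int_combs \<Gamma>" "g \<in> int_combs \<Gamma>"
  shows "struct_mult c f g \<in> int_combs \<Gamma>"
proof -
  have "(\<Union>x\<in>{x. f x \<noteq> 0}. \<Union>y\<in>{y. g y \<noteq> 0}. {z. c x y z \<noteq> 0}) \<subseteq> \<Gamma>"
    using assms c_mem by (fastforce simp: int_combs_def)
  then show ?thesis
    using finite_subset[OF struct_mult_support finite_struct_support[OF assms]] struct_mult_support[of f g]
    by (auto simp: int_combs_def)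
qed

lemma comb_struct_mult:
  assumes f: "f \<in> int_combs \<Gamma>" and g: "g \<in> int_combs \<Gamma>"
  shows "\<iota> (struct_mult c f g) = mat_mult (\<iota> f) (\<iota> g)"
proof (intro ext)
  fix u v
  define F where "F = {x. f x \<noteq> 0}"
  define E where "E = {y. g y \<noteq> 0}"
  \<comment> \<open>\<open>J\<close> and \<open>K\<close> are finite and do not depend on the pair
    \<open>x\<close>, \<open>y\<close> being summed, so that all the sums can be
    interchanged.\<close>
  define J where "J = (\<Union>w\<in>F. {t. X w u t \<noteq> 0})"
  define K where "K = (\<Union>x\<in>F. \<Union>y\<in>E. {z. c x y z \<noteq> 0})"
  have sub: "F \<subseteq> \<Gamma>" "E \<subseteq> \<Gamma>" using f g by (auto simp: int_combs_def F_def E_def)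
  have K: "finite K" using finite_struct_support[OF f g] by (simp add: K_def F_def E_def)
  have J: "finite J"
    using f row_finite_X sub by (auto simp: J_def F_def int_combs_def row_finite_def)
  have prod: "(\<Sum>t\<in>J. X x u t * X y t v) = (\<Sum>z\<in>K. of_int (c x y z) * X z u v)"
    if "x \<in> F" "y \<in> E" for x y
  proof -
    have "(\<Sum>t\<in>J. X x u t * X y t v) = mat_mult (X x) (X y) u v"
      using J that by (subst mat_mult_superset[of J]) (auto simp: J_def)
    also have "\<dots> = int_lin_comb X (c x y) u v"
      using mult_X[of x y] that sub by (simp add: subset_iff)
    also have "\<dots> = (\<Sum>z\<in>K. of_int (c x y z) * X z u v)"
      using K that by (intro int_lin_comb_superset) (auto simp: K_def)
    finally show ?thesis .
  qed
  have "mat_mult (\<iota> f) (\<iota> g) u v = (\<Sum>t\<in>J. \<iota> f u t * \<iota> g t v)"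
    using int_lin_comb_row_subset[of X f u] J by (intro mat_mult_superset) (auto simp: J_def F_def)
  also have "\<dots> = (\<Sum>t\<in>J. \<Sum>x\<in>F. \<Sum>y\<in>E. of_int (f x * g y) * (X x u t * X y t v))"
    by (simp add: int_lin_comb_def F_def E_def sum_product mult_ac)
  also have "\<dots> = (\<Sum>x\<in>F. \<Sum>y\<in>E. of_int (f x * g y) * (\<Sum>t\<in>J. X x u t * X y t v))"
    unfolding sum_distrib_left
    by (subst sum.swap, intro sum.cong refl, subst sum.swap) simp
  also have "\<dots> = (\<Sum>x\<in>F. \<Sum>y\<in>E. of_int (f x * g y) * (\<Sum>z\<in>K. of_int (c x y z) * X z u v))"
    using prod by (intro sum.cong) simp_all
  also have "\<dots> = (\<Sum>z\<in>K. \<Sum>x\<in>F. \<Sum>y\<in>E. of_int (f x * g y * c x y z) * X z u v)"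
    unfolding sum_distrib_left
    by (subst (2) sum.swap, subst sum.swap) (simp add: mult_ac)
  also have "\<dots> = (\<Sum>z\<in>K. of_int (struct_mult c f g z) * X z u v)"
    by (simp add: struct_mult_def F_def E_def of_int_sum sum_distrib_right)
  also have "\<dots> = \<iota> (struct_mult c f g) u v"
    using struct_mult_support[of f g] K
    by (intro int_lin_comb_superset[symmetric]) (auto simp: K_def F_def E_def)
  finally show "\<iota> (struct_mult c f g) u v = mat_mult (\<iota> f) (\<iota> g) u v" by simp
qed

lemma inj_comb: "inj_on \<iota> (int_combs \<Gamma>)"
proof (rule inj_onI)
  fix f g assume f: "f \<in> int_combs \<Gamma>" and g: "g \<in> int_combs \<Gamma>" and eq: "\<iota> f = \<iota> g"
  have "\<iota> (\<lambda>w. f w + - g w) = (\<lambda>u v. 0)"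
    using int_lin_comb_add[OF f int_combs_uminus[OF g], of X] eq by (simp add: int_lin_comb_uminus)
  from independent[OF int_combs_add[OF f int_combs_uminus[OF g]] this]
  show "f = g" by (simp add: fun_eq_iff)
qed

lemma is_rng_matrix_span: "is_rng (matrix_span X \<Gamma>)"
  unfolding is_rng_def matrix_span_def rng.simps partial_object.simps
proof (intro conjI ballI)
  let ?A = "\<iota> ` int_combs \<Gamma>"
  show "comm_group \<lparr>carrier = ?A, monoid.mult = \<lambda>A B u v. A u v + B u v, one = \<lambda>u v. 0\<rparr>"
  proof (rule comm_groupI)
    fix x y assume "x \<in> carrier \<lparr>carrier = ?A, monoid.mult = \<lambda>A B u v. A u v + B u v, one = \<lambda>u v. 0\<rparr>"
      "y \<in> carrier \<lparr>carrier = ?A, monoid.mult = \<lambda>A B u v. A u v + B u v, one = \<lambda>u v. 0\<rparr>"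
    then obtain f g where "f \<in> int_combs \<Gamma>" "g \<in> int_combs \<Gamma>" "x = \<iota> f" "y = \<iota> g" by auto
    then have "(\<lambda>u v. x u v + y u v) \<in> ?A"
      by (auto simp: int_lin_comb_add[symmetric] int_combs_add)
    then show "x \<otimes>\<^bsub>\<lparr>carrier = ?A, monoid.mult = \<lambda>A B u v. A u v + B u v, one = \<lambda>u v. 0\<rparr>\<^esub> y
        \<in> carrier \<lparr>carrier = ?A, monoid.mult = \<lambda>A B u v. A u v + B u v, one = \<lambda>u v. 0\<rparr>" by simp
  next
    have "\<iota> (\<lambda>w. 0) = (\<lambda>u v. 0)" by (intro ext) (simp add: int_lin_comb_def)
    then have "(\<lambda>u v. 0) \<in> ?A" by (metis int_combs_0 imageI)
    then show "\<one>\<^bsub>\<lparr>carrier = ?A, monoid.mult = \<lambda>A B u v. A u v + B u v, one = \<lambda>u v. 0\<rparr>\<^esub>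
        \<in> carrier \<lparr>carrier = ?A, monoid.mult = \<lambda>A B u v. A u v + B u v, one = \<lambda>u v. 0\<rparr>" by simp
  next
    fix x assume "x \<in> carrier \<lparr>carrier = ?A, monoid.mult = \<lambda>A B u v. A u v + B u v, one = \<lambda>u v. 0\<rparr>"
    then obtain f where f: "f \<in> int_combs \<Gamma>" "x = \<iota> f" by auto
    then have "(\<lambda>u v. - x u v) \<in> ?A"
      by (auto simp: int_lin_comb_uminus[symmetric] int_combs_uminus)
    then show "\<exists>y\<in>carrier \<lparr>carrier = ?A, monoid.mult = \<lambda>A B u v. A u v + B u v, one = \<lambda>u v. 0\<rparr>.
        y \<otimes>\<^bsub>\<lparr>carrier = ?A, monoid.mult = \<lambda>A B u v. A u v + B u v, one = \<lambda>u v. 0\<rparr>\<^esub> x =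
        \<one>\<^bsub>\<lparr>carrier = ?A, monoid.mult = \<lambda>A B u v. A u v + B u v, one = \<lambda>u v. 0\<rparr>\<^esub>"
      by (intro bexI[of _ "\<lambda>u v. - x u v"]) simp_all
  qed (simp_all add: add_ac)
  fix x y assume "x \<in> ?A" "y \<in> ?A"
  then obtain f g where fg: "f \<in> int_combs \<Gamma>" "g \<in> int_combs \<Gamma>" "x = \<iota> f" "y = \<iota> g" by auto
  then show "mat_mult x y \<in> ?A"
    by (auto simp: comb_struct_mult[symmetric] struct_mult_mem)
  fix z
  show "mat_mult (mat_mult x y) z = mat_mult x (mat_mult y z)"
    "mat_mult (\<lambda>u v. x u v + y u v) z = (\<lambda>u v. mat_mult x z u v + mat_mult y z u v)"
    "mat_mult x (\<lambda>u v. y u v + z u v) = (\<lambda>u v. mat_mult x y u v + mat_mult x z u v)"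
    using fg by (simp_all add: mat_mult_assoc mat_mult_add_left mat_mult_add_right row_finite_comb)
qed

text \<open>The multiplicative laws are pulled back from matrices along the injective map \<iota>;
  no identity between the constants \<open>c\<close> is computed.\<close>

lemma is_rng_struct_rng: "is_rng (struct_rng \<Gamma> c)"
  unfolding is_rng_def struct_rng_def rng.simps partial_object.simps
proof (intro conjI ballI)
  show "comm_group \<lparr>carrier = int_combs \<Gamma>, monoid.mult = \<lambda>f g w. f w + g w, one = \<lambda>w. 0\<rparr>"
  proof (rule comm_groupI)
    fix x assume "x \<in> carrier \<lparr>carrier = int_combs \<Gamma>, monoid.mult = \<lambda>f g w. f w + g w, one = \<lambda>w. 0\<rparr>"
    then show "\<exists>y\<in>carrier \<lparr>carrier = int_combs \<Gamma>, monoid.mult = \<lambda>f g w. f w + g w, one = \<lambda>w. 0\<rparr>.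
        y \<otimes>\<^bsub>\<lparr>carrier = int_combs \<Gamma>, monoid.mult = \<lambda>f g w. f w + g w, one = \<lambda>w. 0\<rparr>\<^esub> x =
        \<one>\<^bsub>\<lparr>carrier = int_combs \<Gamma>, monoid.mult = \<lambda>f g w. f w + g w, one = \<lambda>w. 0\<rparr>\<^esub>"
      by (intro bexI[of _ "\<lambda>w. - x w"]) (simp_all add: int_combs_uminus)
  qed (simp_all add: add_ac int_combs_add int_combs_0)
  fix x y assume xy: "x \<in> int_combs \<Gamma>" "y \<in> int_combs \<Gamma>"
  then show "struct_mult c x y \<in> int_combs \<Gamma>" by (rule struct_mult_mem)
  fix z assume z: "z \<in> int_combs \<Gamma>"
  note [simp] = xy z struct_mult_mem int_combs_add comb_struct_mult int_lin_comb_add[where \<Gamma> = \<Gamma>]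
    row_finite_comb
  show "struct_mult c (struct_mult c x y) z = struct_mult c x (struct_mult c y z)"
    by (rule inj_onD[OF inj_comb]) (simp_all add: mat_mult_assoc)
  show "struct_mult c (\<lambda>w. x w + y w) z = (\<lambda>w. struct_mult c x z w + struct_mult c y z w)"
    by (rule inj_onD[OF inj_comb]) (simp_all add: mat_mult_add_left)
  show "struct_mult c x (\<lambda>w. y w + z w) = (\<lambda>w. struct_mult c x y w + struct_mult c x z w)"
    by (rule inj_onD[OF inj_comb]) (simp_all add: mat_mult_add_right)
qed

theorem matrix_span_isomorphic: "rng_isomorphic (matrix_span X \<Gamma>) (struct_rng \<Gamma> c)"
  unfolding rng_isomorphic_def
proof (intro conjI exI ballI is_rng_matrix_span is_rng_struct_rng)
  let ?\<phi> = "inv_into (int_combs \<Gamma>) \<iota>"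
  show "bij_betw ?\<phi> (carrier (matrix_span X \<Gamma>)) (carrier (struct_rng \<Gamma> c))"
    by (simp add: matrix_span_def struct_rng_def bij_betw_inv_into inj_comb inj_on_imp_bij_betw)
  fix x y assume "x \<in> carrier (matrix_span X \<Gamma>)" "y \<in> carrier (matrix_span X \<Gamma>)"
  then obtain f g where fg: "f \<in> int_combs \<Gamma>" "g \<in> int_combs \<Gamma>" "x = \<iota> f" "y = \<iota> g"
    by (auto simp: matrix_span_def)
  have inv: "?\<phi> (\<iota> h) = h" if "h \<in> int_combs \<Gamma>" for h
    using that inj_comb by (rule inv_into_f_f[rotated])
  show "?\<phi> (rng_add (matrix_span X \<Gamma>) x y) = rng_add (struct_rng \<Gamma> c) (?\<phi> x) (?\<phi> y)"
    using inv[OF int_combs_add[OF fg(1,2)]] fg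
    by (simp add: matrix_span_def struct_rng_def inv int_lin_comb_add)
  show "?\<phi> (rng_mult (matrix_span X \<Gamma>) x y) = rng_mult (struct_rng \<Gamma> c) (?\<phi> x) (?\<phi> y)"
    using inv[OF struct_mult_mem[OF fg(1,2)]] fg
    by (simp add: matrix_span_def struct_rng_def inv comb_struct_mult)
qed

end

section \<open>Families of representations indexed by the cells\<close>

locale balanced_family =
  fixes G :: "('w, 'b) monoid_scheme" and H :: "(laurent, 'h) module" and C :: "'w \<Rightarrow> 'h"
    and \<rho> :: "'w set \<Rightarrow> ('h, 'm) matrix_rep"
  assumes group_G: "group G" and ring_H: "ring H" and module_H: "Module.module laurent_ring H"
    and basis_C: "is_basis laurent_ring H (carrier G) C"
    and rep: "\<Gamma> \<in> two_sided_cells G H C \<Longrightarrow> matrix_representation H (\<rho> \<Gamma>)"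
    and B1: "\<Gamma> \<in> two_sided_cells G H C \<Longrightarrow> axiom_B1 G H C \<rho> \<Gamma>"
    and B2: "\<Gamma> \<in> two_sided_cells G H C \<Longrightarrow> axiom_B2 G C \<rho> \<Gamma>"
    and B3: "\<Gamma> \<in> two_sided_cells G H C \<Longrightarrow> axiom_B3 G C \<rho> \<Gamma>"
    and B4: "\<Gamma> \<in> two_sided_cells G H C \<Longrightarrow> axiom_B4 G C \<rho> \<Gamma>"
    and B5: "\<Gamma> \<in> two_sided_cells G H C \<Longrightarrow> axiom_B5 G H C \<rho> \<Gamma>"
    and B4': "\<Gamma> \<in> two_sided_cells G H C \<Longrightarrow> axiom_B4' G H C \<rho> \<Gamma>"
begin

section \<open>The cell preorder and its classes\<close>

abbreviation "cells \<equiv> two_sided_cells G H C"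
abbreviation "leq \<equiv> le_LR G H C"
abbreviation "h \<equiv> kl_struct G H C"
abbreviation "bound \<Gamma> \<equiv> int (rep_bound G C (\<rho> \<Gamma>))"

definition cell :: "'w \<Rightarrow> 'w set" where
  "cell w = {z. leq w z \<and> leq z w}"

text \<open>\<open>le_LR\<close> is a transitive closure with no reflexive part added; reflexivity
  comes from multiplying by the unit on both sides.\<close>

lemma leq_refl: "w \<in> carrier G \<Longrightarrow> leq w w"
proof -
  interpret H: ring H by (fact ring_H)
  interpret HC: based_module UNIV H "carrier G" C
    using module_H basis_C by (auto simp: based_module_def based_module_axioms_def laurent_ring_def)
  assume w: "w \<in> carrier G"
  have "coords laurent_ring H (carrier G) C (\<one>\<^bsub>H\<^esub> \<otimes>\<^bsub>H\<^esub> C w \<otimes>\<^bsub>H\<^esub> \<one>\<^bsub>H\<^esub>) w \<noteq> 0"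
    using HC.coords_basis[OF w] HC.basis_closed[OF w] by (simp add: laurent_ring_def)
  then show ?thesis
    unfolding le_LR_def using w H.one_closed by (intro tranclp.r_into_trancl) blast
qed

lemma leq_trans: "leq x y \<Longrightarrow> leq y z \<Longrightarrow> leq x z"
  unfolding le_LR_def by (rule tranclp_trans)

lemma leq_carrier:
  assumes "leq x y"
  shows "x \<in> carrier G" "y \<in> carrier G"
  using assms unfolding le_LR_def by (induction, auto)

lemma cell_mem_cells: "w \<in> carrier G \<Longrightarrow> cell w \<in> cells"
  by (auto simp: two_sided_cells_def cell_def quotient_def)

lemma cells_eq:
  assumes "\<Gamma> \<in> cells"
  obtains w where "w \<in> carrier G" "\<Gamma> = cell w"
  using assms by (auto simp: two_sided_cells_def cell_def quotient_def)

lemma cell_self: "w \<in> carrier G \<Longrightarrow> w \<in> cell w"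
  by (simp add: cell_def leq_refl)

lemma cell_eqI: "\<Gamma> \<in> cells \<Longrightarrow> w \<in> \<Gamma> \<Longrightarrow> cell w = \<Gamma>"
  by (erule cells_eq) (auto simp: cell_def intro: leq_trans)

lemma cells_carrier: "\<Gamma> \<in> cells \<Longrightarrow> w \<in> \<Gamma> \<Longrightarrow> w \<in> carrier G"
  by (erule cells_eq) (auto simp: cell_def dest: leq_carrier)

lemma hecke_rep: "\<Gamma> \<in> cells \<Longrightarrow> hecke_rep G H C (\<rho> \<Gamma>)"
  by (simp add: hecke_rep_def ring_H module_H basis_C rep)

text \<open>B1 puts \<open>w\<close> above \<Gamma>, and B5 reverses the order on bounds. So the
  representation of \<Gamma> detects only elements whose cells have a bound no larger than its
  own.\<close>

lemma bound_le:
  assumes \<Gamma>: "\<Gamma> \<in> cells" and w: "w \<in> carrier G" and nz: "rep_matrix (\<rho> \<Gamma>) (C w) \<noteq> (\<lambda>u v. 0)"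
  shows "bound (cell w) \<le> bound \<Gamma>"
proof -
  have "w \<in> cell_upper G H C \<Gamma>" using B1[OF \<Gamma>] w nz by (auto simp: axiom_B1_def)
  then have "cell_le G H C \<Gamma> (cell w)"
    using cell_self[OF w] by (auto simp: cell_upper_def cell_le_def)
  then show ?thesis
    using B5[OF cell_mem_cells[OF w]] \<Gamma> by (simp add: axiom_B5_def)
qed

text \<open>The cut-off outside \<Gamma> makes B4 applicable. The degree \<open>N\<close> is a
  parameter since it lies above the bound in the degree estimate and equals the bound for the
  constants \<gamma>.\<close>

definition cell_coeffs :: "'w set \<Rightarrow> int \<Rightarrow> 'w \<Rightarrow> 'w \<Rightarrow> 'w \<Rightarrow> int" where
  "cell_coeffs \<Gamma> N x y z = (if z \<in> \<Gamma> then Poly_Mapping.lookup (h x y z) N else 0)"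

lemma finite_h: "\<Gamma> \<in> cells \<Longrightarrow> x \<in> carrier G \<Longrightarrow> y \<in> carrier G \<Longrightarrow> finite {z. h x y z \<noteq> 0}"
  by (rule hecke_rep.finite_kl_struct[OF hecke_rep])

lemma cell_coeffs_support: "{z. cell_coeffs \<Gamma> N x y z \<noteq> 0} \<subseteq> {z. h x y z \<noteq> 0}"
  by (auto simp: cell_coeffs_def)

lemma cell_coeffs_mem:
  assumes "\<Gamma> \<in> cells" "x \<in> carrier G" "y \<in> carrier G"
  shows "cell_coeffs \<Gamma> N x y \<in> int_combs \<Gamma>"
proof -
  have "finite {z. cell_coeffs \<Gamma> N x y z \<noteq> 0}"
    by (rule finite_subset[OF cell_coeffs_support finite_h[OF assms]])
  then show ?thesis by (auto simp: int_combs_def cell_coeffs_def)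
qed

text \<open>Used twice: for \<open>N\<close> above the bound it is a linear relation, for
  \<open>N\<close> equal to the bound it is the multiplication rule. By \<open>bound_le\<close>, the
  degree hypothesis covers every \<open>w\<close> that acts nontrivially and occurs in the
  product.\<close>

lemma cell_coeffs_comb:
  assumes \<Gamma>: "\<Gamma> \<in> cells" and x: "x \<in> carrier G" and y: "y \<in> carrier G" and N: "bound \<Gamma> \<le> N"
    and deg: "\<And>w k. w \<in> carrier G \<Longrightarrow> bound (cell w) \<le> bound \<Gamma> \<Longrightarrow> N < k \<Longrightarrow>
      Poly_Mapping.lookup (h x y w) k = 0"
  shows "int_lin_comb (leading_matrix G C (\<rho> \<Gamma>)) (cell_coeffs \<Gamma> N x y) =
    (if N = bound \<Gamma> then mat_mult (leading_matrix G C (\<rho> \<Gamma>) x) (leading_matrix G C (\<rho> \<Gamma>) y)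
     else (\<lambda>u v. 0))"
proof (intro ext)
  fix u v
  interpret hecke_rep G H C "\<rho> \<Gamma>" by (rule hecke_rep[OF \<Gamma>])
  have bounded: "bounded_rep G C (\<rho> \<Gamma>)" using B2[OF \<Gamma>] by (simp add: axiom_B2_def)
  have deg': "Poly_Mapping.lookup (h x y w) k = 0"
    if nz: "\<P> w \<noteq> (\<lambda>u v. 0)" and k: "N < k" for w k
  \<comment> \<open>A nonzero constant is what shows that \<open>w\<close> lies in the group, as
    \<open>bound_le\<close> requires.\<close>
  proof (cases "h x y w = 0")
    case False
    then have "w \<in> carrier G" by (rule kl_struct_outside[OF x y])
    then show ?thesis using deg bound_le[OF \<Gamma> _ nz] k by simp
  qed simp
  have "int_lin_comb \<c> (cell_coeffs \<Gamma> N x y) u v =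
      (\<Sum>w | h x y w \<noteq> 0. of_int (cell_coeffs \<Gamma> N x y w) * \<c> w u v)"
    by (rule int_lin_comb_superset[OF finite_h[OF \<Gamma> x y] cell_coeffs_support])
  \<comment> \<open>By B3 the leading matrix of \<open>w\<close> vanishes outside \<Gamma>, so
    lifting the cut-off changes no term.\<close>
  also have "\<dots> = (\<Sum>w | h x y w \<noteq> 0. of_int (Poly_Mapping.lookup (h x y w) N) * \<c> w u v)"
  proof (intro sum.cong refl)
    fix w assume "w \<in> {w. h x y w \<noteq> 0}"
    then have "w \<in> carrier G" using kl_struct_outside[OF x y] by simp
    then have "w \<notin> \<Gamma> \<Longrightarrow> \<c> w = (\<lambda>u v. 0)"
      using B3[OF \<Gamma>] by (auto simp: axiom_B3_def)
    then show "of_int (cell_coeffs \<Gamma> N x y w) * \<c> w u v =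
        of_int (Poly_Mapping.lookup (h x y w) N) * \<c> w u v"
      by (cases "w \<in> \<Gamma>") (simp_all add: cell_coeffs_def)
  qed
  also have "\<dots> = (if N = \<a> then \<Sum>t | \<c> x u t \<noteq> 0. \<c> x u t * \<c> y t v else 0)"
    by (rule specialised_product[OF bounded x y N deg'])
  finally show "int_lin_comb \<c> (cell_coeffs \<Gamma> N x y) u v =
      (if N = \<a> then mat_mult (\<c> x) (\<c> y) else (\<lambda>u v. 0)) u v"
    by (simp add: mat_mult_def)
qed

text \<open>Among all violations of the bound, take one in a maximal degree \<open>N\<close>, at \<open>z\<close> say. By B5, in
  the representation of the cell of \<open>z\<close> all the structure constants that matter have degree at most
  \<open>N\<close>, so their coefficients at \<open>N\<close> yield a linear relation between leading matrices.\<close>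

lemma h_degree:
  assumes x: "x \<in> carrier G" and y: "y \<in> carrier G" and z: "z \<in> carrier G"
    and k: "bound (cell z) < k"
  shows "Poly_Mapping.lookup (h x y z) k = 0"
proof (rule ccontr)
  define D where
    "D = {k. \<exists>z\<in>carrier G. bound (cell z) < k \<and> Poly_Mapping.lookup (h x y z) k \<noteq> 0}"
  have "D \<subseteq> (\<Union>z\<in>{z. h x y z \<noteq> 0}. Poly_Mapping.keys (h x y z))"
    by (auto simp: D_def in_keys_iff) (metis lookup_zero)
  then have finD: "finite D"
    by (rule finite_subset) (simp add: finite_h[OF cell_mem_cells[OF z] x y])
  assume "Poly_Mapping.lookup (h x y z) k \<noteq> 0"
  then have "k \<in> D" using z k by (auto simp: D_def)
  define N where "N = Max D"
  have "N \<in> D" using \<open>k \<in> D\<close> finD Max_in unfolding N_def by blast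
  then obtain z' where z': "z' \<in> carrier G" "bound (cell z') < N"
    "Poly_Mapping.lookup (h x y z') N \<noteq> 0" by (auto simp: D_def)
  let ?\<Gamma> = "cell z'"
  have \<Gamma>: "?\<Gamma> \<in> cells" by (rule cell_mem_cells[OF z'(1)])
  \<comment> \<open>Since \<open>bound (cell w) \<le> bound ?\<Gamma> < N < j\<close>, a nonzero
    coefficient would put \<open>j\<close> into \<open>D\<close>, above its maximum.\<close>
  have "Poly_Mapping.lookup (h x y w) j = 0"
    if "w \<in> carrier G" "bound (cell w) \<le> bound ?\<Gamma>" "N < j" for w j
  proof (rule ccontr)
    assume "Poly_Mapping.lookup (h x y w) j \<noteq> 0"
    then have "j \<in> D" using that z'(2) by (auto simp: D_def intro!: bexI[of _ w])
    then show False using Max_ge[OF finD, of j] that(3) by (simp add: N_def)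
  qed
  \<comment> \<open>\<open>N\<close> is strictly above the bound, so the product of leading matrices
    drops out.\<close>
  then have "int_lin_comb (leading_matrix G C (\<rho> ?\<Gamma>)) (cell_coeffs ?\<Gamma> N x y) = (\<lambda>u v. 0)"
    using cell_coeffs_comb[OF \<Gamma> x y, of N] z'(2) by simp
  then have "cell_coeffs ?\<Gamma> N x y = (\<lambda>w. 0)"
    using B4[OF \<Gamma>] cell_coeffs_mem[OF \<Gamma> x y] by (simp add: axiom_B4_def)
  then have "cell_coeffs ?\<Gamma> N x y z' = 0" by simp
  then show False using z'(3) cell_self[OF z'(1)] by (simp add: cell_coeffs_def)
qed

section \<open>Comparison with the a-function and the constants \<gamma>\<close>

lemma a_admissible_rep_bound:
  assumes \<Gamma>: "\<Gamma> \<in> cells" and z: "z \<in> \<Gamma>"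
  shows "a_admissible G H C z (rep_bound G C (\<rho> \<Gamma>))"
  using h_degree[OF _ _ cells_carrier[OF \<Gamma> z]]
  by (simp add: a_admissible_def nonpos_laurent_def lookup_qpow_mult cell_eqI[OF \<Gamma> z])

lemma lusztig_a_eq:
  assumes \<Gamma>: "\<Gamma> \<in> cells" and z: "z \<in> \<Gamma>"
  shows "lusztig_a G H C z = rep_bound G C (\<rho> \<Gamma>)"
  unfolding lusztig_a_def
proof (rule Least_equality)
  show "a_admissible G H C z (rep_bound G C (\<rho> \<Gamma>))"
    by (rule a_admissible_rep_bound[OF \<Gamma> z])
next
  fix n assume n: "a_admissible G H C z n"
  obtain x y where xy: "x \<in> \<Gamma>" "y \<in> \<Gamma>" "Poly_Mapping.lookup (h x y z) (bound \<Gamma>) \<noteq> 0"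
    using B4'[OF \<Gamma>] z by (auto simp: axiom_B4'_def)
  have "qpow (- int n) * h x y z \<in> nonpos_laurent"
    using n cells_carrier[OF \<Gamma>] xy by (simp add: a_admissible_def)
  then have "\<forall>k>0. Poly_Mapping.lookup (h x y z) (k + int n) = 0"
    by (simp add: nonpos_laurent_def lookup_qpow_mult)
  \<comment> \<open>If \<open>n\<close> were smaller than the bound, this positive exponent would
    kill the coefficient that B4' makes nonzero.\<close>
  from this[rule_format, of "bound \<Gamma> - int n"] show "rep_bound G C (\<rho> \<Gamma>) \<le> n"
    using xy(3) by fastforce
qed

text \<open>The two inverses cancel. As the a-function is constant on \<Gamma>, one degree serves
  for all \<open>z\<close>.\<close>

lemma lusztig_gamma_eq:
  assumes \<Gamma>: "\<Gamma> \<in> cells" and z: "z \<in> \<Gamma>"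
  shows "lusztig_gamma G H C x y (inv\<^bsub>G\<^esub> z) = cell_coeffs \<Gamma> (bound \<Gamma>) x y z"
  using group.inv_inv[OF group_G cells_carrier[OF \<Gamma> z]] z
  by (simp add: lusztig_gamma_def cell_coeffs_def lookup_qpow_mult lusztig_a_eq[OF \<Gamma> z])

lemma asymptotic_algebra_eq:
  assumes \<Gamma>: "\<Gamma> \<in> cells"
  shows "asymptotic_algebra G H C \<Gamma> = struct_rng \<Gamma> (cell_coeffs \<Gamma> (bound \<Gamma>))"
proof -
  have "(if z \<in> \<Gamma> then \<Sum>x | f x \<noteq> 0. \<Sum>y | g y \<noteq> 0. f x * g y * lusztig_gamma G H C x y (inv\<^bsub>G\<^esub> z)
      else 0) = struct_mult (cell_coeffs \<Gamma> (bound \<Gamma>)) f g z" for f g z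
  proof (cases "z \<in> \<Gamma>")
    case True
    then show ?thesis by (simp add: struct_mult_def lusztig_gamma_eq[OF \<Gamma>])
  next
    case False
    then show ?thesis by (simp add: struct_mult_def cell_coeffs_def)
  qed
  then show ?thesis unfolding asymptotic_algebra_def struct_rng_def by presburger
qed

lemma leading_ring_eq: "leading_ring G C (\<rho> \<Gamma>) \<Gamma> = matrix_span (leading_matrix G C (\<rho> \<Gamma>)) \<Gamma>"
  by (simp add: leading_ring_def matrix_span_def mat_mult_def[abs_def])

theorem leading_ring_isomorphic:
  assumes \<Gamma>: "\<Gamma> \<in> cells"
  shows "rng_isomorphic (leading_ring G C (\<rho> \<Gamma>) \<Gamma>) (asymptotic_algebra G H C \<Gamma>)"
  unfolding leading_ring_eq asymptotic_algebra_eq[OF \<Gamma>]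
proof (rule matrix_structure_constants.matrix_span_isomorphic, unfold_locales)
  let ?c = "leading_matrix G C (\<rho> \<Gamma>)"
  show "row_finite (?c w)" if "w \<in> \<Gamma>" for w
    using hecke_rep.finite_leading_matrix_row[OF hecke_rep[OF \<Gamma>]] cells_carrier[OF \<Gamma> that]
    by (simp add: row_finite_def)
  show "f = (\<lambda>w. 0)" if "f \<in> int_combs \<Gamma>" "int_lin_comb ?c f = (\<lambda>u v. 0)" for f
    using B4[OF \<Gamma>] that by (simp add: axiom_B4_def)
  fix x y assume "x \<in> \<Gamma>" "y \<in> \<Gamma>"
  then have xy: "x \<in> carrier G" "y \<in> carrier G" using cells_carrier[OF \<Gamma>] by auto
  show "cell_coeffs \<Gamma> (bound \<Gamma>) x y \<in> int_combs \<Gamma>" by (rule cell_coeffs_mem[OF \<Gamma> xy])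
  show "mat_mult (?c x) (?c y) = int_lin_comb ?c (cell_coeffs \<Gamma> (bound \<Gamma>) x y)"
    using cell_coeffs_comb[OF \<Gamma> xy order_refl] h_degree[OF xy] by simp
qed

end

theorem corollary2p7:
  fixes G :: "'w monoid" and S :: "'w set" and L :: "'w \<Rightarrow> nat"
    and H :: "(laurent, 'h) module" and T C :: "'w \<Rightarrow> 'h"
    and \<rho> :: "'w set \<Rightarrow> ('h, 'm) matrix_rep"
  assumes "coxeter_system G S" and "finite S"
    and "positive_weight_function G S L"
    and "hecke_algebra G S L H T"
    and "kazhdan_lusztig_basis G S H T C"
    and "\<And>\<Gamma>. \<Gamma> \<in> two_sided_cells G H C \<Longrightarrow> matrix_representation H (\<rho> \<Gamma>)"
    and "\<And>\<Gamma>. \<Gamma> \<in> two_sided_cells G H C \<Longrightarrow> axiom_B1 G H C \<rho> \<Gamma>"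
    and "\<And>\<Gamma>. \<Gamma> \<in> two_sided_cells G H C \<Longrightarrow> axiom_B2 G C \<rho> \<Gamma>"
    and "\<And>\<Gamma>. \<Gamma> \<in> two_sided_cells G H C \<Longrightarrow> axiom_B3 G C \<rho> \<Gamma>"
    and "\<And>\<Gamma>. \<Gamma> \<in> two_sided_cells G H C \<Longrightarrow> axiom_B4 G C \<rho> \<Gamma>"
    and "\<And>\<Gamma>. \<Gamma> \<in> two_sided_cells G H C \<Longrightarrow> axiom_B5 G H C \<rho> \<Gamma>"
    and "\<And>\<Gamma>. \<Gamma> \<in> two_sided_cells G H C \<Longrightarrow> axiom_B4' G H C \<rho> \<Gamma>"
  shows "\<forall>\<Gamma>\<in>two_sided_cells G H C.
    (\<forall>z\<in>\<Gamma>. \<exists>n. a_admissible G H C z n) \<and>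
    rng_isomorphic (leading_ring G C (\<rho> \<Gamma>) \<Gamma>) (asymptotic_algebra G H C \<Gamma>)"
proof -
  interpret balanced_family G H C \<rho>
  proof (rule balanced_family.intro)
    show "group G"
      using assms(1) by (auto simp: coxeter_system_def group_presented_by_def)
    show "ring H" "Module.module laurent_ring H"
      using assms(4) by (auto simp: hecke_algebra_def)
    show "is_basis laurent_ring H (carrier G) C"
      using assms(5) by (simp add: kazhdan_lusztig_basis_def)
  qed (rule assms(6-12); assumption)+
  \<comment> \<open>The admissibility conjunct certifies that the \<open>LEAST\<close> in
    \<open>lusztig_a\<close> ranges over a nonempty set.\<close>
  show ?thesis
    using a_admissible_rep_bound leading_ring_isomorphic by blast
qed

end
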